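(* (i) The groups $G(\mathcal T,\mathbf 1,\rho(\delta))$, $G(\mathcal O,\mathbf 1,\rho(\delta))$ and $G(\mathcal I,\mathbf 1,\rho(j))$ are conjugate in $\mathrm U_2(\mathbb H)$ to the Shephard and Todd groups $\mathrm{ST}(12)$, $\mathrm{ST}(13)$ and $\mathrm{ST}(22)$ of complex type, respectively. (ii) For all $r\in\mathbb R$ the reflections $R_{r,\delta}$ normalise $G(\mathcal T,\mathbf 1,\rho(\delta))$ and $G(\mathcal O,\mathbf 1,\rho(\delta))$, and the reflections $R_{r,j}$ normalise $G(\mathcal I,\mathbf 1,\rho(j))$.
   Context: $\mathbb H$ is the real quaternion algebra with units $i,j,k$, and $\mathbb S^3$ is the group of quaternions of norm $1$; $\mathbb C$ is identified with $\mathbb R+\mathbb Ri\subset\mathbb H$. $\mathrm U_2(\mathbb H)$ is the group of $2\times2$ quaternionic matrices $A$ with $A\overline A^{\top}=I$, acting on row vectors of the left $\mathbb H$-space $\mathbb H^2$ by right multiplication. A subgroup of $\mathrm U_2(\mathbb C)$, regarded as a subgroup of $\mathrm U_2(\mathbb H)$, is said to be of complex type. $\mathrm{ST}(n)$ denotes the primitive complex reflection group $G_n$ of Shephard and Todd (here of rank two, in $\mathrm U_2(\mathbb C)$), considered as a group of complex type in $\mathrm U_2(\mathbb H)$. For a finite subgroup $K$ of $\mathbb S^3$, $H\trianglelefteq K$ and $\varphi\in\mathrm{Aut}(K/H)$ with $\varphi^2=1$, $G(K,H,\varphi)\subset \mathrm U_2(\mathbb H)$ is the group of order $2|K||H|$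 consisting of all matrices $\mathrm{diag}(\xi,\eta)$ with $\xi,\eta\in K$, $\varphi(H\xi)=H\eta$, together with their products with $\begin{pmatrix}0&1\\1&0\end{pmatrix}$. Here $\mathbf 1$ denotes the trivial group. Let $\varpi=\frac12(-1+i+j+k)$, $\gamma=\frac1{\sqrt2}(1+i)$, $\tau=\frac12(1+\sqrt5)$, $\sigma=\frac12(\tau^{-1}+i+\tau j)$, $\delta=\frac1{\sqrt2}(i-j)$; $\mathcal T=\langle i,j,\varpi\rangle$ (order 24), $\mathcal O=\langle i,j,\varpi,\gamma\rangle$ (order 48), $\mathcal I=\langle i,\sigma\rangle$ (order 120). If $\xi\in\mathbb S^3$ normalises $K$, $\rho(\xi)$ is the automorphism $\eta\mapsto\xi\eta\xi^{-1}$ of $K$. For $r\in\mathbb R$ and $\theta\in\mathbb H$ with $\theta^2=-1$, $R_{r,\theta}=\frac1{\sqrt{1+r^2}}\begin{pmatrix}1&r\theta\\-r\theta&-1\end{pmatrix}$, a reflection of order 2 in $\mathrm U_2(\mathbb H)$. *)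

theory Defs
  imports "HOL-Analysis.Analysis" "HOL-Algebra.Generated_Groups" "HOL-Algebra.Group_Action"
begin

section \<open>The real quaternion algebra\<close>

datatype quat = Quat (qRe: real) (qIm1: real) (qIm2: real) (qIm3: real)

lemma quat_eq_iff:
  "x = y \<longleftrightarrow> qRe x = qRe y \<and> qIm1 x = qIm1 y \<and> qIm2 x = qIm2 y \<and> qIm3 x = qIm3 y"
  by (cases x; cases y) simp

instantiation quat :: ab_group_add
begin

definition "0 = Quat 0 0 0 0"

definition "x + y = Quat (qRe x + qRe y) (qIm1 x + qIm1 y) (qIm2 x + qIm2 y) (qIm3 x + qIm3 y)"

definition "- x = Quat (- qRe x) (- qIm1 x) (- qIm2 x) (- qIm3 x)"

definition "x - y = Quat (qRe x - qRe y) (qIm1 x - qIm1 y) (qIm2 x - qIm2 y) (qIm3 x - qIm3 y)"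

instance
  by standard (simp_all add: quat_eq_iff zero_quat_def plus_quat_def uminus_quat_def minus_quat_def)

end

lemma quat_additive_sel [simp]:
  "qRe 0 = 0" "qIm1 0 = 0" "qIm2 0 = 0" "qIm3 0 = 0"
  "qRe (x + y) = qRe x + qRe y" "qIm1 (x + y) = qIm1 x + qIm1 y"
  "qIm2 (x + y) = qIm2 x + qIm2 y" "qIm3 (x + y) = qIm3 x + qIm3 y"
  "qRe (- x) = - qRe x" "qIm1 (- x) = - qIm1 x" "qIm2 (- x) = - qIm2 x" "qIm3 (- x) = - qIm3 x"
  "qRe (x - y) = qRe x - qRe y" "qIm1 (x - y) = qIm1 x - qIm1 y"
  "qIm2 (x - y) = qIm2 x - qIm2 y" "qIm3 (x - y) = qIm3 x - qIm3 y"
  by (simp_all add: zero_quat_def plus_quat_def uminus_quat_def minus_quat_def)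

instantiation quat :: real_div_algebra
begin

definition "1 = Quat 1 0 0 0"

definition "x * y = Quat
  (qRe x * qRe y - qIm1 x * qIm1 y - qIm2 x * qIm2 y - qIm3 x * qIm3 y)
  (qRe x * qIm1 y + qIm1 x * qRe y + qIm2 x * qIm3 y - qIm3 x * qIm2 y)
  (qRe x * qIm2 y - qIm1 x * qIm3 y + qIm2 x * qRe y + qIm3 x * qIm1 y)
  (qRe x * qIm3 y + qIm1 x * qIm2 y - qIm2 x * qIm1 y + qIm3 x * qRe y)"

definition "scaleR r x = Quat (r * qRe x) (r * qIm1 x) (r * qIm2 x) (r * qIm3 x)"

definition "inverse x =
  (1 / ((qRe x)\<^sup>2 + (qIm1 x)\<^sup>2 + (qIm2 x)\<^sup>2 + (qIm3 x)\<^sup>2)) *\<^sub>R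
    Quat (qRe x) (- qIm1 x) (- qIm2 x) (- qIm3 x)"

definition "x div y = x * inverse y" for x y :: quat

instance
proof
  fix x y z :: quat and a b :: real
  have pos: "(qRe x)\<^sup>2 + (qIm1 x)\<^sup>2 + (qIm2 x)\<^sup>2 + (qIm3 x)\<^sup>2 \<noteq> 0" if "x \<noteq> 0"
  proof
    assume s: "(qRe x)\<^sup>2 + (qIm1 x)\<^sup>2 + (qIm2 x)\<^sup>2 + (qIm3 x)\<^sup>2 = 0"
    have "(qRe x)\<^sup>2 = 0" "(qIm1 x)\<^sup>2 = 0" "(qIm2 x)\<^sup>2 = 0" "(qIm3 x)\<^sup>2 = 0"
      using s zero_le_power2[of "qRe x"] zero_le_power2[of "qIm1 x"]
        zero_le_power2[of "qIm2 x"] zero_le_power2[of "qIm3 x"] by linarith+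
    with that show False by (simp add: quat_eq_iff)
  qed
  show "x * y * z = x * (y * z)"
    by (simp add: quat_eq_iff times_quat_def algebra_simps)
  show "(x + y) * z = x * z + y * z" "x * (y + z) = x * y + x * z"
    by (simp_all add: quat_eq_iff times_quat_def algebra_simps)
  show "1 * x = x" "x * 1 = x" "(0::quat) \<noteq> 1"
    by (simp_all add: quat_eq_iff times_quat_def one_quat_def)
  show "a *\<^sub>R (x + y) = a *\<^sub>R x + a *\<^sub>R y" "(a + b) *\<^sub>R x = a *\<^sub>R x + b *\<^sub>R x"
    "a *\<^sub>R b *\<^sub>R x = (a * b) *\<^sub>R x" "1 *\<^sub>R x = x"
    "a *\<^sub>R x * y = a *\<^sub>R (x * y)" "x * a *\<^sub>R y = a *\<^sub>R (x * y)"
    by (simp_all add: quat_eq_iff times_quat_def scaleR_quat_def algebra_simps)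
  show "inverse x * x = 1" if "x \<noteq> 0"
    using pos[OF that]
    by (simp add: quat_eq_iff times_quat_def one_quat_def inverse_quat_def scaleR_quat_def
        divide_simps) (simp add: algebra_simps power2_eq_square)
  show "x * inverse x = 1" if "x \<noteq> 0"
    using pos[OF that]
    by (simp add: quat_eq_iff times_quat_def one_quat_def inverse_quat_def scaleR_quat_def
        divide_simps) (simp add: algebra_simps power2_eq_square)
  show "x div y = x * inverse y" by (rule divide_quat_def)
  show "inverse (0::quat) = 0"
    by (simp add: quat_eq_iff inverse_quat_def scaleR_quat_def)
qed

end

lemma quat_mult_sel [simp]:
  "qRe 1 = 1" "qIm1 1 = 0" "qIm2 1 = 0" "qIm3 1 = 0"
  "qRe (x * y) = qRe x * qRe y - qIm1 x * qIm1 y - qIm2 x * qIm2 y - qIm3 x * qIm3 y"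
  "qIm1 (x * y) = qRe x * qIm1 y + qIm1 x * qRe y + qIm2 x * qIm3 y - qIm3 x * qIm2 y"
  "qIm2 (x * y) = qRe x * qIm2 y - qIm1 x * qIm3 y + qIm2 x * qRe y + qIm3 x * qIm1 y"
  "qIm3 (x * y) = qRe x * qIm3 y + qIm1 x * qIm2 y - qIm2 x * qIm1 y + qIm3 x * qRe y"
  "qRe (r *\<^sub>R x) = r * qRe x" "qIm1 (r *\<^sub>R x) = r * qIm1 x"
  "qIm2 (r *\<^sub>R x) = r * qIm2 x" "qIm3 (r *\<^sub>R x) = r * qIm3 x"
  by (simp_all add: one_quat_def times_quat_def scaleR_quat_def)

instantiation quat :: real_normed_div_algebra
begin

definition "norm x = sqrt ((qRe x)\<^sup>2 + (qIm1 x)\<^sup>2 + (qIm2 x)\<^sup>2 + (qIm3 x)\<^sup>2)"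

definition sgn_quat_def: "sgn x = x /\<^sub>R norm x" for x :: quat

definition dist_quat_def: "dist x y = norm (x - y)" for x y :: quat

definition uniformity_quat_def [code del]:
  "(uniformity :: (quat \<times> quat) filter) = (INF e\<in>{0 <..}. principal {(x, y). dist x y < e})"

definition open_quat_def [code del]:
  "open (U :: quat set) \<longleftrightarrow> (\<forall>x\<in>U. eventually (\<lambda>(x', y). x' = x \<longrightarrow> y \<in> U) uniformity)"

instance
proof
  fix r :: real and x y :: quat
  have pair: "norm q = norm (Complex (qRe q) (qIm1 q), Complex (qIm2 q) (qIm3 q))" for q :: quat
    by (simp add: norm_quat_def norm_prod_def cmod_power2 add.assoc)
  show "(norm x = 0) = (x = 0)"
    unfolding pair by (simp add: quat_eq_iff zero_prod_def complex_eq_iff)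
  show "norm (x + y) \<le> norm x + norm y"
    unfolding pair
    using norm_triangle_ineq[of "(Complex (qRe x) (qIm1 x), Complex (qIm2 x) (qIm3 x))"
        "(Complex (qRe y) (qIm1 y), Complex (qIm2 y) (qIm3 y))"]
    by (simp add: plus_complex.code)
  show "norm (r *\<^sub>R x) = \<bar>r\<bar> * norm x"
    by (simp add: norm_quat_def power_mult_distrib distrib_left [symmetric] real_sqrt_mult)
  show "norm (x * y) = norm x * norm y"
    by (simp add: norm_quat_def real_sqrt_mult [symmetric] power2_eq_square algebra_simps)
qed (rule sgn_quat_def dist_quat_def open_quat_def uniformity_quat_def)+

end

definition qcnj :: "quat \<Rightarrow> quat"
  where "qcnj x = Quat (qRe x) (- qIm1 x) (- qIm2 x) (- qIm3 x)"

definition qi :: quat where "qi = Quat 0 1 0 0"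
definition qj :: quat where "qj = Quat 0 0 1 0"
definition qk :: quat where "qk = Quat 0 0 0 1"

definition quat_of_complex :: "complex \<Rightarrow> quat"
  where "quat_of_complex z = Quat (Re z) (Im z) 0 0"

lemma qcnj_sel [simp]:
  "qRe (qcnj x) = qRe x" "qIm1 (qcnj x) = - qIm1 x"
  "qIm2 (qcnj x) = - qIm2 x" "qIm3 (qcnj x) = - qIm3 x"
  by (simp_all add: qcnj_def)

lemma quat_units_mult:
  "qi * qi = - 1" "qj * qj = - 1" "qk * qk = - 1"
  "qi * qj = qk" "qj * qk = qi" "qk * qi = qj"
  "qj * qi = - qk" "qk * qj = - qi" "qi * qk = - qj"
  by (simp_all add: quat_eq_iff qi_def qj_def qk_def)

lemma qcnj_add [simp]: "qcnj (x + y) = qcnj x + qcnj y"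
  and qcnj_minus [simp]: "qcnj (- x) = - qcnj x"
  and qcnj_mult [simp]: "qcnj (x * y) = qcnj y * qcnj x"
  and qcnj_qcnj [simp]: "qcnj (qcnj x) = x"
  and qcnj_0 [simp]: "qcnj 0 = 0"
  and qcnj_1 [simp]: "qcnj 1 = 1"
  by (simp_all add: quat_eq_iff algebra_simps)

lemma mult_qcnj: "x * qcnj x = of_real ((norm x)\<^sup>2)" "qcnj x * x = of_real ((norm x)\<^sup>2)"
  by (simp_all add: quat_eq_iff norm_quat_def of_real_def power2_eq_square)

lemma norm_qcnj [simp]: "norm (qcnj x) = norm x"
  by (simp add: norm_quat_def)

section \<open>The ambient groups\<close>

definition S3 :: "quat monoid"
  where "S3 = \<lparr>carrier = {x. norm x = 1}, monoid.mult = (*), one = 1\<rparr>"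

definition hermitian_quat :: "quat^2^2 \<Rightarrow> quat^2^2"
  where "hermitian_quat A = (\<chi> a b. qcnj (A $ b $ a))"

definition hermitian_complex :: "complex^2^2 \<Rightarrow> complex^2^2"
  where "hermitian_complex A = (\<chi> a b. cnj (A $ b $ a))"

definition U2H :: "(quat^2^2) monoid"
  where "U2H = \<lparr>carrier = {A. A ** hermitian_quat A = mat 1}, monoid.mult = (**), one = mat 1\<rparr>"

definition U2C :: "(complex^2^2) monoid"
  where "U2C = \<lparr>carrier = {A. A ** hermitian_complex A = mat 1}, monoid.mult = (**), one = mat 1\<rparr>"

definition mat2 :: "'a::zero \<Rightarrow> 'a \<Rightarrow> 'a \<Rightarrow> 'a \<Rightarrow> 'a^2^2"
  where "mat2 a b c d = vector [vector [a, b], vector [c, d]]"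

lemma group_S3: "group S3"
proof (rule groupI)
  fix x assume x: "x \<in> carrier S3"
  then show "\<exists>y\<in>carrier S3. y \<otimes>\<^bsub>S3\<^esub> x = \<one>\<^bsub>S3\<^esub>"
    by (intro bexI[of _ "qcnj x"]) (simp_all add: S3_def mult_qcnj)
qed (simp_all add: S3_def norm_mult mult.assoc)

lemma matrix_mult_2: "(A ** B) $ i $ j = A $ i $ 1 * B $ 1 $ j + A $ i $ 2 * B $ 2 $ j"
  for A B :: "('a::semiring_1)^2^2"
  by (simp add: matrix_matrix_mult_def sum_2)

lemma hermitian_quat_mult: "hermitian_quat (A ** B) = hermitian_quat B ** hermitian_quat A"
  by (simp add: vec_eq_iff hermitian_quat_def matrix_mult_2)

lemma hermitian_quat_left_inverse:
  assumes "A ** hermitian_quat A = mat 1"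
  shows "hermitian_quat A ** A = mat 1"
proof -
  define a b c d where "a = A $ 1 $ 1" and "b = A $ 1 $ 2" and "c = A $ 2 $ 1" and "d = A $ 2 $ 2"
  note abcd = a_def b_def c_def d_def
  have "(A ** hermitian_quat A) $ i $ j = mat 1 $ i $ j" for i j
    using assms by simp
  from this[of 1 1] this[of 1 2] this[of 2 2]
  have e: "a * qcnj a + b * qcnj b = 1" "a * qcnj c + b * qcnj d = 0" "c * qcnj c + d * qcnj d = 1"
    by (simp_all add: matrix_mult_2 hermitian_quat_def mat_def abcd)
  have n: "(norm a)\<^sup>2 + (norm b)\<^sup>2 = 1" "(norm c)\<^sup>2 + (norm d)\<^sup>2 = 1"
    using e(1,3) unfolding mult_qcnj of_real_add[symmetric] of_real_eq_1_iff by simp_all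
  have ac: "a * qcnj c = - (b * qcnj d)"
    using e(2) by (simp add: eq_neg_iff_add_eq_0)
  have "norm a * norm c = norm b * norm d"
    using arg_cong[OF ac, of norm] by (simp add: norm_mult)
  then have "(norm a)\<^sup>2 * (norm c)\<^sup>2 = (norm b)\<^sup>2 * (norm d)\<^sup>2"
    by (metis power_mult_distrib)
  also have "\<dots> = (1 - (norm a)\<^sup>2) * (1 - (norm c)\<^sup>2)"
  proof -
    have "(norm b)\<^sup>2 = 1 - (norm a)\<^sup>2" "(norm d)\<^sup>2 = 1 - (norm c)\<^sup>2"
      using n by simp_all
    then show ?thesis by (simp only:)
  qed
  finally have nac: "(norm a)\<^sup>2 + (norm c)\<^sup>2 = 1"
    by (simp add: algebra_simps)
  with n have nbd: "(norm b)\<^sup>2 + (norm d)\<^sup>2 = 1" and nad: "(norm a)\<^sup>2 = (norm d)\<^sup>2"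
    by linarith+
  have off: "qcnj a * b + qcnj c * d = 0"
  proof (cases "d = 0")
    case True
    with nad show ?thesis by simp
  next
    case False
    have "(qcnj a * b + qcnj c * d) * qcnj d = qcnj a * (b * qcnj d) + qcnj c * (d * qcnj d)"
      by (simp add: algebra_simps)
    also have "\<dots> = - ((qcnj a * a) * qcnj c) + qcnj c * (d * qcnj d)"
      using ac by (simp add: algebra_simps)
    also have "\<dots> = 0"
      by (simp only: mult_qcnj nad) (simp add: quat_eq_iff of_real_def)
    finally have "(qcnj a * b + qcnj c * d) * qcnj d = 0" .
    moreover have "qcnj d \<noteq> 0" using False by (metis qcnj_qcnj qcnj_0)
    ultimately show ?thesis by simp
  qed
  from arg_cong[OF off, of qcnj] have off': "qcnj b * a + qcnj d * c = 0" by simp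
  have diag: "qcnj a * a + qcnj c * c = 1" "qcnj b * b + qcnj d * d = 1"
    unfolding mult_qcnj of_real_add[symmetric] using nac nbd by simp_all
  show ?thesis
    using off off' diag
    by (simp add: vec_eq_iff forall_2 matrix_mult_2 hermitian_quat_def mat_def abcd)
qed

lemma group_U2H: "group U2H"
proof (rule groupI)
  fix A assume A: "A \<in> carrier U2H"
  have hh: "hermitian_quat (hermitian_quat A) = A"
    by (simp add: hermitian_quat_def vec_eq_iff)
  from A show "\<exists>B\<in>carrier U2H. B \<otimes>\<^bsub>U2H\<^esub> A = \<one>\<^bsub>U2H\<^esub>"
    by (intro bexI[of _ "hermitian_quat A"]) (simp_all add: U2H_def hermitian_quat_left_inverse hh)
next
  fix A B assume "A \<in> carrier U2H" "B \<in> carrier U2H"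
  then have A: "A ** hermitian_quat A = mat 1" and B: "B ** hermitian_quat B = mat 1"
    by (simp_all add: U2H_def)
  have "(A ** B) ** hermitian_quat (A ** B) = A ** (B ** hermitian_quat B) ** hermitian_quat A"
    by (simp add: hermitian_quat_mult matrix_mul_assoc)
  then show "A \<otimes>\<^bsub>U2H\<^esub> B \<in> carrier U2H"
    by (simp add: U2H_def A B)
next
  have "hermitian_quat (mat 1) = mat 1"
    by (simp add: hermitian_quat_def mat_def vec_eq_iff)
  then show "\<one>\<^bsub>U2H\<^esub> \<in> carrier U2H"
    by (simp add: U2H_def)
qed (simp_all add: U2H_def matrix_mul_assoc)

lemma group_U2C: "group U2C"
proof (rule groupI)
  fix A assume A: "A \<in> carrier U2C"
  have hh: "hermitian_complex (hermitian_complex A) = A"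
    by (simp add: hermitian_complex_def vec_eq_iff)
  from A show "\<exists>B\<in>carrier U2C. B \<otimes>\<^bsub>U2C\<^esub> A = \<one>\<^bsub>U2C\<^esub>"
    by (intro bexI[of _ "hermitian_complex A"])
      (simp_all add: U2C_def matrix_left_right_inverse[of "hermitian_complex A"] hh)
next
  fix A B assume "A \<in> carrier U2C" "B \<in> carrier U2C"
  then have A: "A ** hermitian_complex A = mat 1" and B: "B ** hermitian_complex B = mat 1"
    by (simp_all add: U2C_def)
  have "hermitian_complex (A ** B) = hermitian_complex B ** hermitian_complex A"
    by (simp add: vec_eq_iff hermitian_complex_def matrix_mult_2 mult.commute)
  then have "(A ** B) ** hermitian_complex (A ** B)
      = A ** (B ** hermitian_complex B) ** hermitian_complex A"
    by (simp add: matrix_mul_assoc)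
  then show "A \<otimes>\<^bsub>U2C\<^esub> B \<in> carrier U2C"
    by (simp add: U2C_def A B)
next
  have "hermitian_complex (mat 1) = mat 1"
    by (simp add: hermitian_complex_def mat_def vec_eq_iff)
  then show "\<one>\<^bsub>U2C\<^esub> \<in> carrier U2C"
    by (simp add: U2C_def)
qed (simp_all add: U2C_def matrix_mul_assoc)

definition conjugate_in :: "('a, 'b) monoid_scheme \<Rightarrow> 'a set \<Rightarrow> 'a set \<Rightarrow> bool"
  where "conjugate_in G A B \<longleftrightarrow> (\<exists>g\<in>carrier G. g <#\<^bsub>G\<^esub> A #>\<^bsub>G\<^esub> inv\<^bsub>G\<^esub> g = B)"

section \<open>The binary polyhedral groups\<close>

definition qvarpi :: quat where "qvarpi = (1/2) *\<^sub>R (- 1 + qi + qj + qk)"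
definition qgamma :: quat where "qgamma = (1 / sqrt 2) *\<^sub>R (1 + qi)"
definition golden :: real where "golden = (1 + sqrt 5) / 2"
definition qsigma :: quat where "qsigma = (1/2) *\<^sub>R (of_real (inverse golden) + qi + golden *\<^sub>R qj)"
definition qdelta :: quat where "qdelta = (1 / sqrt 2) *\<^sub>R (qi - qj)"

definition binary_tetrahedral :: "quat set"
  where "binary_tetrahedral = generate S3 {qi, qj, qvarpi}"

definition binary_octahedral :: "quat set"
  where "binary_octahedral = generate S3 {qi, qj, qvarpi, qgamma}"

definition binary_icosahedral :: "quat set"
  where "binary_icosahedral = generate S3 {qi, qsigma}"

section \<open>The imprimitive groups \<open>G(K, H, \<phi>)\<close>\<close>

definition rho :: "quat \<Rightarrow> quat \<Rightarrow> quat"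
  where "rho \<xi> \<eta> = \<xi> * \<eta> * inverse \<xi>"

text \<open>
  The argument \<open>\<phi>\<close> acts on the cosets that form \<open>K/H\<close>.  For a \<open>\<xi>\<close> normalising \<open>K\<close> and \<open>H\<close>, the
  automorphism of \<open>K/H\<close> that \<open>rho \<xi>\<close> induces sends a coset to its image under \<open>rho \<xi>\<close>; it is
  therefore written \<open>image (rho \<xi>)\<close>.  For \<open>H = {1}\<close> this is \<open>rho \<xi>\<close> under the identification
  of \<open>K/{1}\<close> with \<open>K\<close>.
\<close>

definition Gdiag :: "quat set \<Rightarrow> quat set \<Rightarrow> (quat set \<Rightarrow> quat set) \<Rightarrow> (quat^2^2) set"
  where "Gdiag K H \<phi> =
    {mat2 \<xi> 0 0 \<eta> | \<xi> \<eta>. \<xi> \<in> K \<and> \<eta> \<in> K \<and> \<phi> (H #>\<^bsub>S3\<^esub> \<xi>) = H #>\<^bsub>S3\<^esub> \<eta>}"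

definition Ggroup :: "quat set \<Rightarrow> quat set \<Rightarrow> (quat set \<Rightarrow> quat set) \<Rightarrow> (quat^2^2) set"
  where "Ggroup K H \<phi> = Gdiag K H \<phi> \<union> (\<lambda>A. A ** mat2 0 1 1 0) ` Gdiag K H \<phi>"

definition reflR :: "real \<Rightarrow> quat \<Rightarrow> quat^2^2"
  where "reflR r \<theta> = (1 / sqrt (1 + r\<^sup>2)) *\<^sub>R mat2 1 (r *\<^sub>R \<theta>) (- (r *\<^sub>R \<theta>)) (- 1)"

section \<open>The Shephard-Todd groups of rank two that occur\<close>

text \<open>
  Shephard and Todd (Canad. J. Math. 6, 1954) obtain the primitive reflection groups of rank two by
  rescaling generators \<open>S\<close>, \<open>T\<close> of the polyhedral collineation groups: each group is generated by
  \<open>\<lambda> S\<close> and \<open>\<mu> T\<close> for suitable roots of unity, with \<open>(\<lambda>, \<mu>) = (\<i>, 1)\<close> for number 12 and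
  \<open>(\<i>, \<i>)\<close> for number 13 (both octahedral), and \<open>(\<i>, 1)\<close> for number 22 (icosahedral).
  The groups have orders 48, 96 and 240; their reflections all have order 2, there are 12, 18 and
  30 of them, and they generate the group.
\<close>

definition ST_octa_S :: "complex^2^2"
  where "ST_octa_S = (1 / sqrt 2) *\<^sub>R mat2 \<i> 1 (- 1) (- \<i>)"

definition ST_octa_T :: "complex^2^2"
  where "ST_octa_T = (let \<epsilon> = cis (2 * pi / 8) in (1 / sqrt 2) *\<^sub>R mat2 \<epsilon> \<epsilon> (\<epsilon> ^ 3) (\<epsilon> ^ 7))"

definition ST_icosa_S :: "complex^2^2"
  where "ST_icosa_S = (let \<eta> = cis (2 * pi / 5) in
    (1 / sqrt 5) *\<^sub>R mat2 (\<eta> ^ 4 - \<eta>) (\<eta>\<^sup>2 - \<eta> ^ 3) (\<eta>\<^sup>2 - \<eta> ^ 3) (\<eta> - \<eta> ^ 4))"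

definition ST_icosa_T :: "complex^2^2"
  where "ST_icosa_T = (let \<eta> = cis (2 * pi / 5) in
    (1 / sqrt 5) *\<^sub>R mat2 (\<eta>\<^sup>2 - \<eta> ^ 4) (\<eta> ^ 4 - 1) (1 - \<eta>) (\<eta> ^ 3 - \<eta>))"

definition ST12 :: "(complex^2^2) set"
  where "ST12 = generate U2C {mat \<i> ** ST_octa_S, ST_octa_T}"

definition ST13 :: "(complex^2^2) set"
  where "ST13 = generate U2C {mat \<i> ** ST_octa_S, mat \<i> ** ST_octa_T}"

definition ST22 :: "(complex^2^2) set"
  where "ST22 = generate U2C {mat \<i> ** ST_icosa_S, ST_icosa_T}"

definition complex_type :: "(complex^2^2) set \<Rightarrow> (quat^2^2) set"
  where "complex_type X = (\<lambda>A. \<chi> a b. quat_of_complex (A $ a $ b)) ` X"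

end

theory Submission
  imports Defs
begin

text \<open>
  For \<open>\<delta>\<^sup>2 = -1\<close>, conjugation by \<open>diag(1, \<delta>\<^sup>-\<^sup>1)\<close> turns \<open>diag(\<xi>, \<delta>\<xi>\<delta>\<^sup>-\<^sup>1)\<close> into the scalar \<open>\<xi>\<close> and the swap
  into \<open>\<delta> J\<close>, where \<open>J\<close> is the real rotation by a right angle.  A further conjugation carries \<open>J\<close>
  to the scalar \<open>i\<close>, whose centraliser is \<open>U2C\<close>: the scalars \<open>\<xi>\<close> become the elements of \<open>SU(2)\<close>,
  so \<open>G(K, 1, \<rho>(\<delta>))\<close> becomes \<open>K \<union> i K \<delta>\<close> inside \<open>U2C\<close>.  It remains to compare generators with
  those of Shephard and Todd.  After the first conjugation the reflections \<open>R\<close> become real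
  matrices; they commute with the scalars and anticommute with \<open>J\<close>, so they normalise the group.
\<close>

section \<open>Quaternionic and complex matrices\<close>

lemma mat2_sel [simp]:
  "mat2 a b c d $ 1 $ 1 = a" "mat2 a b c d $ 1 $ 2 = b"
  "mat2 a b c d $ 2 $ 1 = c" "mat2 a b c d $ 2 $ 2 = d"
  by (simp_all add: mat2_def)

lemma mat2_eq_iff: "A = B \<longleftrightarrow> A$1$1 = B$1$1 \<and> A$1$2 = B$1$2 \<and> A$2$1 = B$2$1 \<and> A$2$2 = B$2$2"
  for A B :: "'a^2^2"
  by (auto simp: vec_eq_iff forall_2)

lemma mat2_mult:
  "mat2 a b c d ** mat2 a' b' c' d' =
    mat2 (a * a' + b * c') (a * b' + b * d') (c * a' + d * c') (c * b' + d * d')"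
  for a :: "'a::semiring_1"
  by (simp add: mat2_eq_iff matrix_mult_2)

lemma mat_eq_mat2: "mat x = mat2 x 0 0 x"
  by (simp add: mat2_eq_iff mat_def)

lemma scaleR_mat2: "r *\<^sub>R mat2 a b c d = mat2 (r *\<^sub>R a) (r *\<^sub>R b) (r *\<^sub>R c) (r *\<^sub>R d)"
  by (simp add: mat2_eq_iff)

lemma scaleR_matrix_mult:
  "(r *\<^sub>R A) ** B = r *\<^sub>R (A ** B)" "A ** (r *\<^sub>R B) = r *\<^sub>R (A ** B)"
  for A B :: "('a::real_algebra_1)^2^2"
  by (simp_all add: mat2_eq_iff matrix_mult_2 scaleR_add_right)

lemma hermitian_quat_scaleR: "hermitian_quat (r *\<^sub>R A) = r *\<^sub>R hermitian_quat A"
  by (simp add: vec_eq_iff hermitian_quat_def quat_eq_iff)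

lemma qunit_sel [simp]:
  "qRe qi = 0" "qIm1 qi = 1" "qIm2 qi = 0" "qIm3 qi = 0"
  "qRe qj = 0" "qIm1 qj = 0" "qIm2 qj = 1" "qIm3 qj = 0"
  "qRe qk = 0" "qIm1 qk = 0" "qIm2 qk = 0" "qIm3 qk = 1"
  by (simp_all add: qi_def qj_def qk_def)

lemma quat_numeral_sel [simp]:
  "qRe (numeral n) = numeral n" "qIm1 (numeral n) = 0" "qIm2 (numeral n) = 0" "qIm3 (numeral n) = 0"
  unfolding of_real_numeral[where 'a = quat, symmetric] by (simp_all add: of_real_def)

lemma qcnj_qunit [simp]: "qcnj qi = - qi" "qcnj qj = - qj" "qcnj qk = - qk"
  by (simp_all add: quat_eq_iff)

lemma norm_quat_eq_1_iff:
  "norm x = 1 \<longleftrightarrow> (qRe x)\<^sup>2 + (qIm1 x)\<^sup>2 + (qIm2 x)\<^sup>2 + (qIm3 x)\<^sup>2 = 1"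
  by (simp add: norm_quat_def)

lemma inverse_unit_quat:
  fixes x :: quat
  assumes "norm x = 1"
  shows "inverse x = qcnj x"
  by (rule inverse_unique) (simp add: mult_qcnj assms)

lemma carrier_S3 [simp]: "x \<in> carrier S3 \<longleftrightarrow> norm x = 1"
  and mult_S3 [simp]: "x \<otimes>\<^bsub>S3\<^esub> y = x * y"
  and one_S3 [simp]: "\<one>\<^bsub>S3\<^esub> = 1"
  by (simp_all add: S3_def)

lemma inv_S3 [simp]:
  assumes "norm x = 1"
  shows "inv\<^bsub>S3\<^esub> x = inverse x"
proof -
  have "x * inverse x = 1" using assms by (intro right_inverse) auto
  with assms show ?thesis
    by (intro group.inv_equality[OF group_S3])
      (auto simp: norm_inverse intro!: left_inverse)
qed

lemma mult_U2C [simp]: "A \<otimes>\<^bsub>U2C\<^esub> B = A ** B" and one_U2C [simp]: "\<one>\<^bsub>U2C\<^esub> = mat 1"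
  by (simp_all add: U2C_def)

lemma mult_U2H [simp]: "A \<otimes>\<^bsub>U2H\<^esub> B = A ** B" and one_U2H [simp]: "\<one>\<^bsub>U2H\<^esub> = mat 1"
  by (simp_all add: U2H_def)

text \<open>The isomorphism of S3 with SU(2): for x = a + b j with a, b complex, the rows are the
  coordinates of x and j x in the left C-basis 1, j.\<close>

definition su2 :: "quat \<Rightarrow> complex^2^2"
  where "su2 x = mat2 (Complex (qRe x) (qIm1 x)) (Complex (qIm2 x) (qIm3 x))
    (Complex (- qIm2 x) (qIm3 x)) (Complex (qRe x) (- qIm1 x))"

lemma su2_mult: "su2 (x * y) = su2 x ** su2 y"
  by (simp add: su2_def mat2_mult complex_eq_iff mat2_eq_iff)

lemma su2_1 [simp]: "su2 1 = mat 1"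
  by (simp add: su2_def mat_eq_mat2 mat2_eq_iff complex_eq_iff)

lemma su2_minus: "su2 (- x) = mat (- 1) ** su2 x"
  by (simp add: su2_def mat_eq_mat2 mat2_mult mat2_eq_iff complex_eq_iff)

lemma mat_complex_commute: "A ** mat c = mat c ** A" for A :: "complex^2^2"
  by (simp add: mat_eq_mat2 mat2_eq_iff matrix_mult_2 mult.commute)

lemma mat_mult_mat: "mat c ** mat d = (mat (c * d) :: complex^2^2)"
  by (simp add: mat_eq_mat2 mat2_eq_iff matrix_mult_2)

lemma su2_carrier:
  assumes "norm x = 1"
  shows "su2 x \<in> carrier U2C"
  using assms unfolding norm_quat_eq_1_iff U2C_def
  by (simp add: mat2_eq_iff matrix_mult_2 hermitian_complex_def su2_def mat_def complex_eq_iff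
      power2_eq_square algebra_simps)

lemma scalar_i_carrier: "mat \<i> \<in> carrier U2C"
  by (simp add: U2C_def mat2_eq_iff matrix_mult_2 hermitian_complex_def mat_def)

section \<open>The complex form of \<open>G(K, 1, \<phi>)\<close>\<close>

text \<open>
  \<open>rot g\<close> is conjugation by \<open>g\<close> followed by the embedding of \<open>S3\<close> in \<open>U2C\<close>.  The freedom to choose
  \<open>g\<close> is only needed to match the generators of the icosahedral group.
\<close>

definition rot :: "quat \<Rightarrow> quat \<Rightarrow> complex^2^2"
  where "rot g \<xi> = su2 (g * \<xi> * inverse g)"

definition complex_form :: "quat \<Rightarrow> quat \<Rightarrow> quat set \<Rightarrow> (complex^2^2) set"
  where "complex_form g \<delta> K = rot g ` K \<union> (\<lambda>\<xi>. mat \<i> ** rot g (\<xi> * \<delta>)) ` K"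

lemma rot_mult:
  assumes "g \<noteq> 0"
  shows "rot g (x * y) = rot g x ** rot g y"
proof -
  have "g * (x * y) * inverse g = (g * x * inverse g) * (g * y * inverse g)"
    using assms by (simp add: mult.assoc) (simp add: mult.assoc[symmetric] assms)
  then show ?thesis by (simp add: rot_def su2_mult)
qed

lemma rot_1 [simp]: "g \<noteq> 0 \<Longrightarrow> rot g 1 = mat 1"
  by (simp add: rot_def)

lemma rot_minus: "rot g (- x) = mat (- 1) ** rot g x"
  by (simp add: rot_def su2_minus)

lemma rot_carrier: "g \<noteq> 0 \<Longrightarrow> norm x = 1 \<Longrightarrow> rot g x \<in> carrier U2C"
  by (simp add: rot_def su2_carrier norm_mult norm_inverse)

text \<open>The scalar \<open>mat \<i>\<close> is central, and its square -1 is absorbed into the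
  quaternion. With \<open>rot_mult\<close>, products in U2C reduce to products of
  quaternions.\<close>

lemma i_rot_mult:
  assumes "g \<noteq> 0"
  shows "(mat \<i> ** rot g x) ** rot g y = mat \<i> ** rot g (x * y)"
    and "rot g x ** (mat \<i> ** rot g y) = mat \<i> ** rot g (x * y)"
    and "(mat \<i> ** rot g x) ** (mat \<i> ** rot g y) = rot g (- (x * y))"
proof -
  show "(mat \<i> ** rot g x) ** rot g y = mat \<i> ** rot g (x * y)"
    by (simp add: rot_mult assms matrix_mul_assoc)
  show *: "rot g x ** (mat \<i> ** rot g y) = mat \<i> ** rot g (x * y)"
    by (metis rot_mult assms matrix_mul_assoc mat_complex_commute)
  have "(mat \<i> ** rot g x) ** (mat \<i> ** rot g y) = mat \<i> ** (mat \<i> ** rot g (x * y))"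
    by (simp add: * matrix_mul_assoc[symmetric])
  also have "\<dots> = mat (- 1) ** rot g (x * y)"
    by (simp add: matrix_mul_assoc mat_mult_mat)
  finally show "(mat \<i> ** rot g x) ** (mat \<i> ** rot g y) = rot g (- (x * y))"
    by (simp add: rot_minus)
qed

section \<open>Conjugating G(K, 1, \<rho>(\<delta>)) into U2C\<close>

abbreviation quat_matrix :: "complex^2^2 \<Rightarrow> quat^2^2"
  where "quat_matrix A \<equiv> (\<chi> a b. quat_of_complex (A $ a $ b))"

text \<open>For trivial H the coset condition reads \<eta> = \<rho>(\<delta>)\<xi>, so one parameter
  is left; right multiplication by the swap exchanges the columns.\<close>

lemma Ggroup_rho:
  assumes K: "subgroup K S3" and n: "norm \<delta> = 1" and d: "\<And>\<xi>. \<xi> \<in> K \<Longrightarrow> rho \<delta> \<xi> \<in> K"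
  shows "Ggroup K {1} (image (rho \<delta>)) =
    (\<lambda>\<xi>. mat2 \<xi> 0 0 (rho \<delta> \<xi>)) ` K \<union> (\<lambda>\<xi>. mat2 0 \<xi> (rho \<delta> \<xi>) 0) ` K"
proof -
  have "Gdiag K {1} (image (rho \<delta>)) = (\<lambda>\<xi>. mat2 \<xi> 0 0 (rho \<delta> \<xi>)) ` K"
    using d by (auto simp: Gdiag_def r_coset_def)
  then show ?thesis
    by (simp add: Ggroup_def image_image mat2_mult)
qed

text \<open>A square root of -1 is a pure unit quaternion. The last equation frees
  \<open>rho \<delta>\<close> of the inverse, so that rewriting with \<delta>\<delta> = -1 can
  evaluate it.\<close>

lemma mult_self_unit_pure:
  fixes \<delta> :: quat
  assumes "\<delta> * \<delta> = - 1"
  shows "norm \<delta> = 1" "inverse \<delta> = - \<delta>" "qcnj \<delta> = - \<delta>" "rho \<delta> \<xi> = - (\<delta> * \<xi> * \<delta>)"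
proof -
  have "norm \<delta> * norm \<delta> = 1"
    by (metis assms norm_mult norm_minus_cancel norm_one)
  then show n: "norm \<delta> = 1"
    by (metis abs_norm_cancel abs_square_eq_1 power2_eq_square)
  show i: "inverse \<delta> = - \<delta>"
    using assms by (intro inverse_unique) simp
  show "qcnj \<delta> = - \<delta>" using inverse_unit_quat[OF n] i by simp
  show "rho \<delta> \<xi> = - (\<delta> * \<xi> * \<delta>)" by (simp add: rho_def i)
qed

lemma Ggroup_carrier:
  assumes K: "subgroup K S3" and \<delta>: "\<delta> * \<delta> = - 1" and d: "\<And>\<xi>. \<xi> \<in> K \<Longrightarrow> rho \<delta> \<xi> \<in> K"
  shows "Ggroup K {1} (image (rho \<delta>)) \<subseteq> carrier U2H"
proof -
  have n: "norm x = 1" if "x \<in> K" for x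
    using subgroup.mem_carrier[OF K that] by simp
  have "Ggroup K {1} (image (rho \<delta>)) =
      (\<lambda>\<xi>. mat2 \<xi> 0 0 (rho \<delta> \<xi>)) ` K \<union> (\<lambda>\<xi>. mat2 0 \<xi> (rho \<delta> \<xi>) 0) ` K"
    using K mult_self_unit_pure(1)[OF \<delta>] d by (rule Ggroup_rho)
  then show ?thesis
    by (auto simp: U2H_def mat2_eq_iff matrix_mult_2 hermitian_quat_def mat_def mult_qcnj n d)
qed

lemma subgroup_minus_closed:
  assumes "subgroup K S3" "- 1 \<in> K" "\<xi> \<in> K"
  shows "- \<xi> \<in> K"
  using subgroup.m_closed[OF assms] by simp

text \<open>Up to the sign of the second column, these are the entries of the identity
  \<open>su2 \<zeta>\<close> P = P \<zeta> for the matrix P with rows (1, -i) and (j, -k).\<close>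

lemma su2_components:
  shows "quat_matrix (su2 \<zeta>) $ 1 $ 1 + quat_matrix (su2 \<zeta>) $ 1 $ 2 * qj = \<zeta>"
    and "quat_matrix (su2 \<zeta>) $ 1 $ 1 * qi + quat_matrix (su2 \<zeta>) $ 1 $ 2 * qk = qi * \<zeta>"
    and "quat_matrix (su2 \<zeta>) $ 2 $ 1 + quat_matrix (su2 \<zeta>) $ 2 $ 2 * qj = qj * \<zeta>"
    and "quat_matrix (su2 \<zeta>) $ 2 $ 1 * qi + quat_matrix (su2 \<zeta>) $ 2 $ 2 * qk = qk * \<zeta>"
  by (simp_all add: su2_def quat_eq_iff quat_of_complex_def)

text \<open>
  \<open>Q\<close> is \<open>P diag(g, g \<delta>\<^sup>-\<^sup>1)\<close>, where \<open>P\<close> has the rows \<open>(1, -i)\<close> and \<open>(j, -k)\<close> divided by \<open>\<surd>2\<close> and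
  satisfies \<open>P J = i P\<close>.
\<close>

lemma complex_form_intertwiner:
  fixes g \<delta> :: quat
  assumes g: "norm g = 1" and \<delta>: "\<delta> * \<delta> = - 1"
  defines "Q \<equiv> (1 / sqrt 2) *\<^sub>R mat2 g (qi * g * \<delta>) (qj * g) (qk * g * \<delta>)"
  shows "Q \<in> carrier U2H"
    and "Q ** mat2 \<xi> 0 0 (rho \<delta> \<xi>) = quat_matrix (rot g \<xi>) ** Q"
    and "Q ** mat2 0 \<xi> (rho \<delta> \<xi>) 0 = quat_matrix (mat \<i> ** rot g (\<xi> * \<delta>)) ** Q"
proof -
  \<comment> \<open>Products are nested to the right below, so each cancellation is stated with a
    trailing factor x.\<close>
  have \<delta>\<delta>: "\<delta> * (\<delta> * x) = - x" for x
    by (metis \<delta> mult.assoc mult_minus1)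
  have gg: "inverse g * (g * x) = x" for x
    using g by (metis left_inverse mult.assoc mult_1 norm_zero zero_neq_one)
  have gg': "g * (qcnj g * x) = x" for x
    by (metis g mult_qcnj(1) mult.assoc mult_1 of_real_1 one_power2)
  have dd': "\<delta> * (qcnj \<delta> * x) = x" for x
    by (simp add: mult_self_unit_pure(3)[OF \<delta>] \<delta>\<delta>)
  note r = mult_self_unit_pure(4)[OF \<delta>]
  define Q' where "Q' = mat2 g (qi * g * \<delta>) (qj * g) (qk * g * \<delta>)"
  have Q: "Q = (1 / sqrt 2) *\<^sub>R Q'"
    by (simp add: Q_def Q'_def)
  have Q_mult: "Q ** X = Y ** Q" if "Q' ** X = Y ** Q'" for X Y
    using that by (simp add: Q scaleR_matrix_mult)
  \<comment> \<open>Multiplication by \<open>su2 \<zeta>\<close> inserts \<zeta> directly before g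
    in every entry; for \<zeta> = g \<xi> \<open>inverse g\<close> the factor g then
    cancels.\<close>
  have comp: "quat_matrix (su2 \<zeta>) ** Q' =
      mat2 (\<zeta> * g) (qi * \<zeta> * g * \<delta>) (qj * \<zeta> * g) (qk * \<zeta> * g * \<delta>)" for \<zeta>
  proof -
    define a b c d where "a = quat_matrix (su2 \<zeta>) $ 1 $ 1" and "b = quat_matrix (su2 \<zeta>) $ 1 $ 2"
      and "c = quat_matrix (su2 \<zeta>) $ 2 $ 1" and "d = quat_matrix (su2 \<zeta>) $ 2 $ 2"
    note abcd = this
    have *: "a * x + b * (qj * x) = \<zeta> * x" "a * (qi * x) + b * (qk * x) = qi * (\<zeta> * x)"
      "c * x + d * (qj * x) = qj * (\<zeta> * x)" "c * (qi * x) + d * (qk * x) = qk * (\<zeta> * x)" for x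
      unfolding abcd
      by (simp_all only: su2_components mult.assoc[symmetric] distrib_right[symmetric])
    show ?thesis
      by (simp only: mat2_eq_iff matrix_mult_2 Q'_def mat2_sel mult.assoc abcd[symmetric] *)
  qed
  have "Q' ** hermitian_quat Q' = mat2 2 0 0 2"
    using gg'[of 1]
    by (simp add: mat2_eq_iff matrix_mult_2 hermitian_quat_def Q'_def mult.assoc gg' dd'
        quat_units_mult)
  then have "Q ** hermitian_quat Q = (1 / 2) *\<^sub>R mat2 2 0 0 2"
    by (simp add: Q scaleR_matrix_mult hermitian_quat_scaleR)
  then show "Q \<in> carrier U2H"
    by (simp add: U2H_def mat2_eq_iff mat_def quat_eq_iff)
  have "Q' ** mat2 \<xi> 0 0 (rho \<delta> \<xi>) = quat_matrix (rot g \<xi>) ** Q'"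
    unfolding rot_def comp
    using gg[of 1] by (simp add: Q'_def mat2_mult r mult.assoc gg \<delta>\<delta>)
  then show "Q ** mat2 \<xi> 0 0 (rho \<delta> \<xi>) = quat_matrix (rot g \<xi>) ** Q"
    by (rule Q_mult)
  have units: "qi * (qi * x) = - x" "qi * (qj * x) = qk * x" "qi * (qk * x) = - (qj * x)" for x
    by (simp_all add: quat_units_mult flip: mult.assoc)
  have scalar_i: "quat_matrix (mat \<i> ** A) = mat qi ** quat_matrix A" for A
    by (simp add: mat2_eq_iff matrix_mult_2 mat_def quat_of_complex_def quat_eq_iff)
  have "Q' ** mat2 0 \<xi> (rho \<delta> \<xi>) 0 = quat_matrix (mat \<i> ** rot g (\<xi> * \<delta>)) ** Q'"
    unfolding rot_def scalar_i matrix_mul_assoc[symmetric] comp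
    using gg[of 1]
    by (simp add: Q'_def mat_eq_mat2 mat2_mult r mult.assoc gg \<delta>\<delta> \<delta> units)
  then show "Q ** mat2 0 \<xi> (rho \<delta> \<xi>) 0 = quat_matrix (mat \<i> ** rot g (\<xi> * \<delta>)) ** Q"
    by (rule Q_mult)
qed

lemma conjugate_image:
  "q <#\<^bsub>G\<^esub> A #>\<^bsub>G\<^esub> r = (\<lambda>a. q \<otimes>\<^bsub>G\<^esub> a \<otimes>\<^bsub>G\<^esub> r) ` A"
  by (auto simp: l_coset_def r_coset_def)

lemma conjugate_in_complex_form:
  fixes g \<delta> :: quat
  assumes K: "subgroup K S3" and g: "norm g = 1" and \<delta>: "\<delta> * \<delta> = - 1"
    and d: "\<And>\<xi>. \<xi> \<in> K \<Longrightarrow> rho \<delta> \<xi> \<in> K"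
  shows "conjugate_in U2H (Ggroup K {1} (image (rho \<delta>))) (complex_type (complex_form g \<delta> K))"
proof -
  interpret U2H: group U2H by (rule group_U2H)
  define Q where "Q = (1 / sqrt 2) *\<^sub>R mat2 g (qi * g * \<delta>) (qj * g) (qk * g * \<delta>)"
  note Q = complex_form_intertwiner[OF g \<delta>, folded Q_def]
  have QQ: "Q ** inv\<^bsub>U2H\<^esub> Q = mat 1"
    using U2H.r_inv[OF Q(1)] by simp
  have "Q ** A ** inv\<^bsub>U2H\<^esub> Q = B" if "Q ** A = B ** Q" for A B
    unfolding that using QQ by (simp flip: matrix_mul_assoc)
  note conj = this[OF Q(2)] this[OF Q(3)]
  have G: "Ggroup K {1} (image (rho \<delta>)) =
      (\<lambda>\<xi>. mat2 \<xi> 0 0 (rho \<delta> \<xi>)) ` K \<union> (\<lambda>\<xi>. mat2 0 \<xi> (rho \<delta> \<xi>) 0) ` K"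
    using K mult_self_unit_pure(1)[OF \<delta>] d by (rule Ggroup_rho)
  have "Q <#\<^bsub>U2H\<^esub> Ggroup K {1} (image (rho \<delta>)) #>\<^bsub>U2H\<^esub> inv\<^bsub>U2H\<^esub> Q
      = complex_type (complex_form g \<delta> K)"
    unfolding conjugate_image G
    by (simp add: image_Un image_image conj complex_type_def complex_form_def)
  with Q(1) show ?thesis by (auto simp: conjugate_in_def)
qed

section \<open>Group structure and generators of the complex form\<close>

lemma complex_form_subgroup:
  assumes K: "subgroup K S3" and g: "g \<noteq> 0" and \<delta>: "\<delta> * \<delta> = - 1" "- 1 \<in> K"
    and d: "\<And>\<xi>. \<xi> \<in> K \<Longrightarrow> rho \<delta> \<xi> \<in> K"
  shows "subgroup (complex_form g \<delta> K) U2C"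
proof -
  interpret U2C: group U2C by (rule group_U2C)
  interpret K: subgroup K S3 by (rule K)
  have nK: "norm \<xi> = 1" if "\<xi> \<in> K" for \<xi>
    using K.mem_carrier[OF that] by simp
  note n\<delta> = mult_self_unit_pure(1)[OF \<delta>(1)]
  have KK: "x * y \<in> K" if "x \<in> K" "y \<in> K" for x y
    using K.m_closed[OF that] by simp
  have Kinv: "inverse x \<in> K" if "x \<in> K" for x
    using K.m_inv_closed[OF that] nK[OF that] by simp
  \<comment> \<open>This moves \<delta> to the right past K. Since the scalar i and \<delta> both
    square to -1, i \<delta> is an involution normalising K, whence closure under products.\<close>
  have shift: "\<delta> * x = rho \<delta> x * \<delta>" for x
    using n\<delta> by (auto simp: rho_def mult.assoc)
  have mem1: "rot g x \<in> complex_form g \<delta> K" if "x \<in> K" for x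
    using that by (auto simp: complex_form_def)
  have mem2: "mat \<i> ** rot g (x * \<delta>) \<in> complex_form g \<delta> K" if "x \<in> K" for x
    using that by (auto simp: complex_form_def)
  have car: "complex_form g \<delta> K \<subseteq> carrier U2C"
    using U2C.m_closed[OF scalar_i_carrier rot_carrier[OF g]]
    by (auto simp: complex_form_def rot_carrier[OF g] nK n\<delta> norm_mult)
  have cases: "\<exists>\<xi>\<in>K. A = rot g \<xi> \<or> A = mat \<i> ** rot g (\<xi> * \<delta>)"
    if "A \<in> complex_form g \<delta> K" for A
    using that by (auto simp: complex_form_def)
  show ?thesis
  proof (rule U2C.subgroupI)
    show "complex_form g \<delta> K \<subseteq> carrier U2C" by (rule car)
    show "complex_form g \<delta> K \<noteq> {}" using \<delta>(2) by (auto simp: complex_form_def)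
  next
    fix A B assume A: "A \<in> complex_form g \<delta> K" and B: "B \<in> complex_form g \<delta> K"
    obtain x where x: "x \<in> K" "A = rot g x \<or> A = mat \<i> ** rot g (x * \<delta>)"
      using cases[OF A] by blast
    obtain y where y: "y \<in> K" "B = rot g y \<or> B = mat \<i> ** rot g (y * \<delta>)"
      using cases[OF B] by blast
    have "x * \<delta> * y = x * rho \<delta> y * \<delta>"
      by (simp add: mult.assoc shift)
    moreover have "- (x * \<delta> * (y * \<delta>)) = x * rho \<delta> y"
      by (simp add: mult_self_unit_pure(4)[OF \<delta>(1)] mult.assoc)
    ultimately have
      "rot g x ** rot g y = rot g (x * y)"
      "rot g x ** (mat \<i> ** rot g (y * \<delta>)) = mat \<i> ** rot g (x * y * \<delta>)"
      "(mat \<i> ** rot g (x * \<delta>)) ** rot g y = mat \<i> ** rot g (x * rho \<delta> y * \<delta>)"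
      "(mat \<i> ** rot g (x * \<delta>)) ** (mat \<i> ** rot g (y * \<delta>)) = rot g (x * rho \<delta> y)"
      by (simp_all only: i_rot_mult[OF g] rot_mult[OF g, symmetric] mult.assoc)
    with x y show "A \<otimes>\<^bsub>U2C\<^esub> B \<in> complex_form g \<delta> K"
      by (auto intro!: mem1 mem2 KK d)
  next
    fix A assume A: "A \<in> complex_form g \<delta> K"
    have AU: "A \<in> carrier U2C" using A car by blast
    obtain x where x: "x \<in> K" "A = rot g x \<or> A = mat \<i> ** rot g (x * \<delta>)"
      using cases[OF A] by blast
    have x0: "x \<noteq> 0" using nK[OF x(1)] by auto
    \<comment> \<open>With the involution s = i \<delta>, the inverse of x s is s
      \<open>inverse x\<close>, which equals \<rho>(\<delta>)(\<open>inverse x\<close>) s.\<close>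
    define B where "B = (if A = rot g x then rot g (inverse x)
      else mat \<i> ** rot g (rho \<delta> (inverse x) * \<delta>))"
    have B: "B \<in> complex_form g \<delta> K"
      by (simp add: B_def mem1 mem2 Kinv d x)
    have e: "- (rho \<delta> (inverse x) * \<delta> * (x * \<delta>)) = 1"
      using x0 by (simp add: shift[symmetric] \<delta>(1) mult.assoc)
        (simp add: mult.assoc[symmetric] x0 \<delta>(1))
    have "B ** A = mat 1"
      using x(2) x0 e g
      by (auto simp: B_def i_rot_mult simp flip: rot_mult)
    then have "inv\<^bsub>U2C\<^esub> A = B"
      using AU B car by (intro U2C.inv_equality) auto
    with B show "inv\<^bsub>U2C\<^esub> A \<in> complex_form g \<delta> K" by simp
  qed
qed

text \<open>\<open>rot g\<close> is a homomorphism. This lets the inclusion of the image of K in H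
  be checked on generators of K.\<close>

lemma subgroup_preimage_rot:
  assumes H: "subgroup H U2C" and g: "g \<noteq> 0"
  shows "subgroup {\<xi>. norm \<xi> = 1 \<and> rot g \<xi> \<in> H} S3"
proof -
  interpret S3: group S3 by (rule group_S3)
  interpret U2C: group U2C by (rule group_U2C)
  interpret H: subgroup H U2C by (rule H)
  have inv: "rot g (inverse x) \<in> H" if "norm x = 1" "rot g x \<in> H" for x
  proof -
    have "x \<noteq> 0" using that by auto
    then have "rot g (inverse x) ** rot g x = mat 1"
      by (simp add: g flip: rot_mult)
    then have "inv\<^bsub>U2C\<^esub> rot g x = rot g (inverse x)"
      using that by (intro U2C.inv_equality) (auto simp: rot_carrier g norm_inverse)
    with H.m_inv_closed[OF that(2)] show ?thesis by simp
  qed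
  show ?thesis
    using H.one_closed H.m_closed
    by (intro S3.subgroupI) (auto simp: norm_mult norm_inverse rot_mult g inv intro!: exI[of _ 1])
qed

text \<open>Both inclusions are tested on generators: the complex form is generated by the image of
  K and the single element i \<delta>.\<close>

lemma complex_form_eq_generate:
  assumes K: "K = generate S3 A" "A \<subseteq> {\<xi>. norm \<xi> = 1 \<and> rot g \<xi> \<in> generate U2C B}"
    and g: "g \<noteq> 0" and \<delta>: "\<delta> * \<delta> = - 1" "- 1 \<in> K" "\<And>\<xi>. \<xi> \<in> K \<Longrightarrow> rho \<delta> \<xi> \<in> K"
    and B: "B \<subseteq> complex_form g \<delta> K" and i\<delta>: "mat \<i> ** rot g \<delta> \<in> generate U2C B"
  shows "complex_form g \<delta> K = generate U2C B"
proof
  have sK: "subgroup K S3"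
    using K by (auto intro!: group.generate_is_subgroup group_S3)
  have sub: "subgroup (complex_form g \<delta> K) U2C"
    using sK g \<delta> by (rule complex_form_subgroup)
  show "generate U2C B \<subseteq> complex_form g \<delta> K"
    using B sub by (rule group.generate_subgroup_incl[OF group_U2C])
  have "B \<subseteq> carrier U2C" using B subgroup.subset[OF sub] by blast
  then have sH: "subgroup (generate U2C B) U2C"
    by (rule group.generate_is_subgroup[OF group_U2C])
  have "K \<subseteq> {\<xi>. norm \<xi> = 1 \<and> rot g \<xi> \<in> generate U2C B}"
    unfolding K(1) using K(2) subgroup_preimage_rot[OF sH g]
    by (rule group.generate_subgroup_incl[OF group_S3])
  moreover have "mat \<i> ** rot g (\<xi> * \<delta>) \<in> generate U2C B" if "rot g \<xi> \<in> generate U2C B" for \<xi>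
    using subgroup.m_closed[OF sH that i\<delta>] by (simp add: i_rot_mult g)
  ultimately show "complex_form g \<delta> K \<subseteq> generate U2C B"
    by (auto simp: complex_form_def)
qed

section \<open>The reflections normalising the groups\<close>

text \<open>Conjugating twice by an involution is the identity, so the inclusion of R A R in A
  already forces equality.\<close>

lemma involution_in_normalizer:
  assumes G: "group G" and R: "R \<in> carrier G" and A: "A \<subseteq> carrier G"
    and RR: "R \<otimes>\<^bsub>G\<^esub> R = \<one>\<^bsub>G\<^esub>"
    and RA: "\<And>a. a \<in> A \<Longrightarrow> R \<otimes>\<^bsub>G\<^esub> a \<otimes>\<^bsub>G\<^esub> R \<in> A"
  shows "R \<in> normalizer G A"
proof -
  interpret group G by (rule G)
  have inv: "inv\<^bsub>G\<^esub> R = R" by (rule inv_equality[OF RR R R])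
  have twice: "R \<otimes>\<^bsub>G\<^esub> (R \<otimes>\<^bsub>G\<^esub> a \<otimes>\<^bsub>G\<^esub> R) \<otimes>\<^bsub>G\<^esub> R = a" if "a \<in> carrier G" for a
  proof -
    have "R \<otimes>\<^bsub>G\<^esub> (R \<otimes>\<^bsub>G\<^esub> a) = a"
      using that R RR by (simp flip: m_assoc)
    then show ?thesis using that R RR by (simp add: m_assoc)
  qed
  have "(\<lambda>a. R \<otimes>\<^bsub>G\<^esub> a \<otimes>\<^bsub>G\<^esub> R) ` A = A"
  proof
    show "A \<subseteq> (\<lambda>a. R \<otimes>\<^bsub>G\<^esub> a \<otimes>\<^bsub>G\<^esub> R) ` A"
    proof
      fix a assume a: "a \<in> A"
      then show "a \<in> (\<lambda>a. R \<otimes>\<^bsub>G\<^esub> a \<otimes>\<^bsub>G\<^esub> R) ` A"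
        using A RA[OF a] twice[of a] by (intro image_eqI[of a _ "R \<otimes>\<^bsub>G\<^esub> a \<otimes>\<^bsub>G\<^esub> R"]) auto
    qed
  qed (use RA in auto)
  with R A show ?thesis
    by (simp add: normalizer_def stabilizer_def conjugate_image inv)
qed

text \<open>Conjugation by the reflection fixes each diagonal element and replaces \<xi> by -\<xi>
  in each antidiagonal one, whence the condition that -1 lies in K. The factor 1 + r^2 is split off
  by computing with the unnormalised R.\<close>

lemma reflR_in_normalizer:
  assumes K: "subgroup K S3" and \<delta>: "\<delta> * \<delta> = - 1" "- 1 \<in> K"
    and d: "\<And>\<xi>. \<xi> \<in> K \<Longrightarrow> rho \<delta> \<xi> \<in> K"
  shows "reflR r \<delta> \<in> normalizer U2H (Ggroup K {1} (image (rho \<delta>)))"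
proof -
  define R where "R = mat2 1 (r *\<^sub>R \<delta>) (- (r *\<^sub>R \<delta>)) (- 1)"
  have refl: "reflR r \<delta> = (1 / sqrt (1 + r\<^sup>2)) *\<^sub>R R"
    by (simp add: reflR_def R_def)
  have \<delta>\<delta>: "\<delta> * (\<delta> * x) = - x" for x
    by (metis \<delta>(1) mult.assoc mult_minus1)
  note rho = mult_self_unit_pure(4)[OF \<delta>(1)]
  have scale: "1 / sqrt (1 + r\<^sup>2) * (1 / sqrt (1 + r\<^sup>2)) * (1 + r\<^sup>2) = 1"
    using sum_power2_gt_zero_iff[of 1 r] by (simp add: field_simps)
  have RXR: "reflR r \<delta> ** X ** reflR r \<delta> = Y" if "R ** X ** R = (1 + r\<^sup>2) *\<^sub>R Y" for X Y
    using that scale by (simp add: refl scaleR_matrix_mult)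
  have RR: "R ** R = (1 + r\<^sup>2) *\<^sub>R mat 1"
    by (simp add: R_def mat2_mult mat_eq_mat2 mat2_eq_iff \<delta> power2_eq_square scaleR_add_left)
  have R1: "R ** mat2 \<xi> 0 0 (rho \<delta> \<xi>) ** R = (1 + r\<^sup>2) *\<^sub>R mat2 \<xi> 0 0 (rho \<delta> \<xi>)" for \<xi>
    by (simp add: R_def mat2_mult mat2_eq_iff rho mult.assoc \<delta>\<delta> \<delta> power2_eq_square scaleR_add_left)
  have R2: "R ** mat2 0 \<xi> (rho \<delta> \<xi>) 0 ** R = (1 + r\<^sup>2) *\<^sub>R mat2 0 (- \<xi>) (rho \<delta> (- \<xi>)) 0" for \<xi>
    by (simp add: R_def mat2_mult mat2_eq_iff rho mult.assoc \<delta>\<delta> \<delta> power2_eq_square scaleR_add_left)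
  have G: "Ggroup K {1} (image (rho \<delta>)) =
      (\<lambda>\<xi>. mat2 \<xi> 0 0 (rho \<delta> \<xi>)) ` K \<union> (\<lambda>\<xi>. mat2 0 \<xi> (rho \<delta> \<xi>) 0) ` K"
    using K mult_self_unit_pure(1)[OF \<delta>(1)] d by (rule Ggroup_rho)
  \<comment> \<open>As \<delta> is pure, its conjugate is -\<delta>, which is the sign between the
    off-diagonal entries. Unitarity then follows from the involution property.\<close>
  have herm: "hermitian_quat (reflR r \<delta>) = reflR r \<delta>"
    by (simp add: reflR_def hermitian_quat_scaleR)
      (simp add: mat2_eq_iff hermitian_quat_def quat_eq_iff
        mult_self_unit_pure(3)[OF \<delta>(1), unfolded quat_eq_iff, simplified])
  have inv: "reflR r \<delta> ** reflR r \<delta> = mat 1"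
    using RXR[of "mat 1"] RR by simp
  show ?thesis
  proof (rule involution_in_normalizer[OF group_U2H])
    show "reflR r \<delta> \<in> carrier U2H" by (simp add: U2H_def herm inv)
    show "Ggroup K {1} (image (rho \<delta>)) \<subseteq> carrier U2H"
      using K \<delta>(1) d by (rule Ggroup_carrier)
    show "reflR r \<delta> \<otimes>\<^bsub>U2H\<^esub> a \<otimes>\<^bsub>U2H\<^esub> reflR r \<delta> \<in> Ggroup K {1} (image (rho \<delta>))"
      if "a \<in> Ggroup K {1} (image (rho \<delta>))" for a
      using that subgroup_minus_closed[OF K \<delta>(2)]
      unfolding G by (auto simp: RXR[OF R1] RXR[OF R2])
  qed (simp add: inv)
qed

section \<open>The groups generated by the given reflections\<close>

text \<open>The four cases say which factors carry the scalar i. Later memberships are words in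
  quaternions assembled by these rules.\<close>

lemma generate_rot_mult:
  assumes "g \<noteq> 0"
  shows "rot g x \<in> generate U2C B \<Longrightarrow> rot g y \<in> generate U2C B \<Longrightarrow> rot g (x * y) \<in> generate U2C B"
    and "mat \<i> ** rot g x \<in> generate U2C B \<Longrightarrow> rot g y \<in> generate U2C B
      \<Longrightarrow> mat \<i> ** rot g (x * y) \<in> generate U2C B"
    and "rot g x \<in> generate U2C B \<Longrightarrow> mat \<i> ** rot g y \<in> generate U2C B
      \<Longrightarrow> mat \<i> ** rot g (x * y) \<in> generate U2C B"
    and "mat \<i> ** rot g x \<in> generate U2C B \<Longrightarrow> mat \<i> ** rot g y \<in> generate U2C B
      \<Longrightarrow> rot g (- (x * y)) \<in> generate U2C B"
  using generate.eng[of "rot g x" U2C B "rot g y"]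
    generate.eng[of "mat \<i> ** rot g x" U2C B "rot g y"]
    generate.eng[of "rot g x" U2C B "mat \<i> ** rot g y"]
    generate.eng[of "mat \<i> ** rot g x" U2C B "mat \<i> ** rot g y"]
  by (simp_all add: i_rot_mult assms flip: rot_mult)

lemma generate_S3_mult: "x \<in> generate S3 A \<Longrightarrow> y \<in> generate S3 A \<Longrightarrow> x * y \<in> generate S3 A"
  using generate.eng[of x S3 A y] by simp

lemma generate_S3_inverse:
  assumes "\<And>a. a \<in> A \<Longrightarrow> norm a = 1" "x \<in> generate S3 A"
  shows "inverse x \<in> generate S3 A"
proof -
  have A: "A \<subseteq> carrier S3" using assms(1) by auto
  have "norm x = 1"
    using group.generate_in_carrier[OF group_S3 A assms(2)] by simp
  then show ?thesis
    using group.generate_m_inv_closed[OF group_S3 A assms(2)] by simp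
qed

text \<open>Conjugation is multiplicative, so it suffices to test invariance on the
  generators.\<close>

lemma rho_generate:
  assumes A: "\<And>a. a \<in> A \<Longrightarrow> norm a = 1" and \<delta>: "\<delta> \<noteq> 0"
    and rho: "\<And>a. a \<in> A \<Longrightarrow> rho \<delta> a \<in> generate S3 A"
    and x: "x \<in> generate S3 A"
  shows "rho \<delta> x \<in> generate S3 A"
  using x
proof induction
  case one
  then show ?case using generate.one[of S3 A] \<delta> by (simp add: rho_def)
next
  case (incl h)
  then show ?case by (rule rho)
next
  case (inv h)
  have h: "h \<noteq> 0" using A[OF inv] by auto
  have "rho \<delta> (inverse h) = inverse (rho \<delta> h)"
    using \<delta> h by (simp add: rho_def nonzero_inverse_mult_distrib mult.assoc)
  then show ?case
    using generate_S3_inverse[OF A rho[OF inv]] A[OF inv] by simp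
next
  case (eng x y)
  have "rho \<delta> (x * y) = rho \<delta> x * rho \<delta> y"
    using \<delta> by (simp add: rho_def mult.assoc) (simp add: mult.assoc[symmetric] \<delta>)
  then show ?case
    using generate_S3_mult[OF eng.IH] by simp
qed

lemma subgroup_generate_S3:
  assumes "\<And>a. a \<in> A \<Longrightarrow> norm a = 1"
  shows "subgroup (generate S3 A) S3"
  using assms by (intro group.generate_is_subgroup[OF group_S3]) auto

subsection \<open>The tetrahedral and octahedral groups\<close>

lemma qvarpi_sel [simp]:
  "qRe qvarpi = - (1/2)" "qIm1 qvarpi = 1/2" "qIm2 qvarpi = 1/2" "qIm3 qvarpi = 1/2"
  by (simp_all add: qvarpi_def)

lemma qgamma_sel [simp]:
  "qRe qgamma = 1 / sqrt 2" "qIm1 qgamma = 1 / sqrt 2" "qIm2 qgamma = 0" "qIm3 qgamma = 0"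
  by (simp_all add: qgamma_def)

lemma qdelta_sel [simp]:
  "qRe qdelta = 0" "qIm1 qdelta = 1 / sqrt 2" "qIm2 qdelta = - (1 / sqrt 2)" "qIm3 qdelta = 0"
  by (simp_all add: qdelta_def)

lemma octa_generator_norms:
  "a \<in> {qi, qj, qvarpi, qgamma} \<Longrightarrow> norm a = 1"
  by (auto simp: norm_quat_eq_1_iff power2_eq_square)

lemma qdelta_square: "qdelta * qdelta = - 1"
  by (simp add: quat_eq_iff)

text \<open>\<open>octa_s\<close> = (i + j)/sqrt 2 and \<open>octa_t\<close> = (1 + i + j + k)/2 are
  the \<open>su2\<close> preimages of \<open>ST_octa_S\<close> and \<open>ST_octa_T\<close>.
  Factoring out \<delta> shows that i \<open>octa_s\<close> has the form i \<xi> \<delta> with \<xi>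
  = k.\<close>

definition octa_s :: quat where "octa_s = qk * qdelta"
definition octa_t :: quat where "octa_t = - (qvarpi * qvarpi)"

lemma octa_s_sel [simp]:
  "qRe octa_s = 0" "qIm1 octa_s = 1 / sqrt 2" "qIm2 octa_s = 1 / sqrt 2" "qIm3 octa_s = 0"
  by (simp_all add: octa_s_def)

lemma octa_t_sel [simp]:
  "qRe octa_t = 1/2" "qIm1 octa_t = 1/2" "qIm2 octa_t = 1/2" "qIm3 octa_t = 1/2"
  by (simp_all add: octa_t_def)

text \<open>Words recovering i, j, \<varpi>, \<gamma> and \<delta> from s and t. Their signs are
  those produced when two factors carrying the scalar i are multiplied in
  \<open>generate_rot_mult\<close>.\<close>

lemma octa_relations:
  "octa_t * octa_t * octa_t = - 1"
  "octa_t * - (octa_s * (octa_t * octa_s)) = qj"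
  "- (octa_s * (octa_t * octa_s)) * octa_t = qi"
  "octa_t * octa_t = qvarpi"
  "- 1 * (qi * qj * octa_s) = qdelta"
  "- 1 * (qi * octa_s * octa_t) = qgamma"
  "qj * qgamma * qvarpi = qdelta"
  by (simp_all add: quat_eq_iff)

lemma ST_octa_S_rot: "ST_octa_S = rot 1 octa_s"
  by (simp add: ST_octa_S_def rot_def su2_def scaleR_mat2 mat2_eq_iff complex_eq_iff)

lemma ST_octa_T_rot: "ST_octa_T = rot 1 octa_t"
proof -
  define \<epsilon> where "\<epsilon> = cis (2 * pi / 8)"
  have \<epsilon>: "\<epsilon> = Complex (1 / sqrt 2) (1 / sqrt 2)"
    by (simp add: \<epsilon>_def complex_eq_iff cos_45 sin_45 real_div_sqrt)
  have "\<epsilon> ^ 2 = \<i>"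
    by (simp add: \<epsilon> power2_eq_square complex_eq_iff)
  moreover have "\<epsilon> ^ 3 = \<epsilon>\<^sup>2 * \<epsilon>" "\<epsilon> ^ 7 = (\<epsilon>\<^sup>2) ^ 3 * \<epsilon>"
    by (simp_all add: eval_nat_numeral mult.assoc)
  ultimately have "\<epsilon> ^ 3 = \<i> * \<epsilon>" "\<epsilon> ^ 7 = - \<i> * \<epsilon>"
    by (simp_all add: power3_eq_cube)
  then show ?thesis
    unfolding ST_octa_T_def \<epsilon>_def[symmetric] Let_def
    by (simp add: rot_def su2_def scaleR_mat2 mat2_eq_iff complex_eq_iff \<epsilon>)
qed

lemma qunits_generate:
  assumes "{qi, qj} \<subseteq> generate S3 A"
  shows "qk \<in> generate S3 A" "- 1 \<in> generate S3 A"
    "\<And>x. x \<in> generate S3 A \<Longrightarrow> - x \<in> generate S3 A"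
proof -
  have "qi * qj \<in> generate S3 A" "qi * qi \<in> generate S3 A"
    using assms by (simp_all add: generate_S3_mult)
  then show "qk \<in> generate S3 A" and *: "- 1 \<in> generate S3 A" by (simp_all add: quat_units_mult)
  show "- x \<in> generate S3 A" if "x \<in> generate S3 A" for x
    using generate_S3_mult[OF * that] by simp
qed

lemma tetrahedral_normalised:
  assumes "\<xi> \<in> binary_tetrahedral"
  shows "rho qdelta \<xi> \<in> binary_tetrahedral"
  unfolding binary_tetrahedral_def
proof (rule rho_generate)
  let ?K = "generate S3 {qi, qj, qvarpi}"
  show "norm a = 1" if "a \<in> {qi, qj, qvarpi}" for a
    using octa_generator_norms[of a] that by auto
  show "\<xi> \<in> ?K" using assms by (simp add: binary_tetrahedral_def)
  have K: "qi \<in> ?K" "qj \<in> ?K" "qvarpi \<in> ?K" by (auto intro: generate.incl)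
  have K': "- qi \<in> ?K" "- qj \<in> ?K" "qvarpi * qvarpi \<in> ?K"
    using K by (simp_all add: qunits_generate(3) generate_S3_mult)
  have "rho qdelta qi = - qj" "rho qdelta qj = - qi" "rho qdelta qvarpi = qvarpi * qvarpi"
    by (simp_all add: mult_self_unit_pure(4)[OF qdelta_square] quat_eq_iff)
  then show "rho qdelta a \<in> ?K" if "a \<in> {qi, qj, qvarpi}" for a
    using that K' by auto
qed (auto simp: quat_eq_iff)

text \<open>Hence \<rho>(\<delta>) is inner on the octahedral group; on the tetrahedral group the
  images of the generators are computed instead.\<close>

lemma qdelta_octahedral: "qdelta \<in> binary_octahedral"
proof -
  have "qj * qgamma * qvarpi \<in> binary_octahedral"
    unfolding binary_octahedral_def by (intro generate_S3_mult generate.incl) auto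
  then show ?thesis by (simp only: octa_relations)
qed

lemma subgroup_binary:
  "subgroup binary_tetrahedral S3" "subgroup binary_octahedral S3"
  using octa_generator_norms
  by (auto simp: binary_tetrahedral_def binary_octahedral_def intro!: subgroup_generate_S3)

lemma binary_minus_1: "- 1 \<in> binary_tetrahedral" "- 1 \<in> binary_octahedral"
  unfolding binary_tetrahedral_def binary_octahedral_def
  by (rule qunits_generate; auto intro: generate.incl)+

lemma subgroup_rho_closed:
  assumes "subgroup K S3" "\<delta> \<in> K" "\<xi> \<in> K"
  shows "rho \<delta> \<xi> \<in> K"
proof -
  have "norm \<delta> = 1" using subgroup.mem_carrier[OF assms(1,2)] by simp
  then show ?thesis
    using subgroup.m_closed[OF assms(1) subgroup.m_closed[OF assms] subgroup.m_inv_closed[OF assms(1,2)]]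
    by (simp add: rho_def)
qed

lemma complex_form_tetrahedral: "complex_form 1 qdelta binary_tetrahedral = ST12"
proof -
  let ?B = "{mat \<i> ** ST_octa_S, ST_octa_T}"
  let ?H = "generate U2C ?B"
  note mult = generate_rot_mult[of 1 _ ?B, simplified]
  have s: "mat \<i> ** rot 1 octa_s \<in> ?H" and t: "rot 1 octa_t \<in> ?H"
    by (auto intro!: generate.incl simp: ST_octa_S_rot ST_octa_T_rot)
  have u: "rot 1 (- (octa_s * (octa_t * octa_s))) \<in> ?H"
    by (intro mult s t)
  have m1: "rot 1 (- 1) \<in> ?H"
    using mult(1)[OF mult(1)[OF t t] t] by (simp only: octa_relations(1))
  have i: "rot 1 qi \<in> ?H"
    using mult(1)[OF u t] by (simp only: octa_relations)
  have j: "rot 1 qj \<in> ?H"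
    using mult(1)[OF t u] by (simp only: octa_relations)
  have v: "rot 1 qvarpi \<in> ?H"
    using mult(1)[OF t t] by (simp only: octa_relations)
  have d: "mat \<i> ** rot 1 qdelta \<in> ?H"
    using mult(3)[OF m1 mult(3)[OF mult(1)[OF i j] s]] by (simp only: octa_relations)
  have K: "qk \<in> binary_tetrahedral" "octa_t \<in> binary_tetrahedral"
    unfolding binary_tetrahedral_def octa_t_def
    by (intro qunits_generate generate_S3_mult; auto intro: generate.incl)+
  show ?thesis
    unfolding ST12_def
  proof (rule complex_form_eq_generate[OF binary_tetrahedral_def])
    show "{qi, qj, qvarpi} \<subseteq> {\<xi>. norm \<xi> = 1 \<and> rot 1 \<xi> \<in> ?H}"
      using octa_generator_norms i j v by auto
    show "?B \<subseteq> complex_form 1 qdelta binary_tetrahedral"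
      using K by (auto simp: complex_form_def ST_octa_S_rot ST_octa_T_rot octa_s_def)
  qed (use d binary_minus_1 qdelta_square tetrahedral_normalised in auto)
qed

lemma complex_form_octahedral: "complex_form 1 qdelta binary_octahedral = ST13"
proof -
  let ?B = "{mat \<i> ** ST_octa_S, mat \<i> ** ST_octa_T}"
  let ?H = "generate U2C ?B"
  note mult = generate_rot_mult[of 1 _ ?B, simplified]
  have s': "mat \<i> ** rot 1 octa_s \<in> ?H" and t': "mat \<i> ** rot 1 octa_t \<in> ?H"
    by (auto intro!: generate.incl simp: ST_octa_S_rot ST_octa_T_rot)
  \<comment> \<open>The cube of i t is i^3 t^3 = i, as t^3 = -1. So the scalar i lies in the group
    and can be stripped from the generators.\<close>
  have "mat \<i> ** rot 1 (- (octa_t * octa_t) * octa_t) \<in> ?H"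
    by (intro mult t')
  then have i1: "mat \<i> ** rot 1 1 \<in> ?H"
    by (simp only: octa_relations(1) mult_minus_left minus_minus)
  have m1: "rot 1 (- 1) \<in> ?H"
    using mult(4)[OF i1 i1] by simp
  have toL: "rot 1 x \<in> ?H" if "mat \<i> ** rot 1 x \<in> ?H" for x
    using mult(1)[OF m1 mult(4)[OF i1 that]] by simp
  note s = toL[OF s'] and t = toL[OF t']
  have u: "rot 1 (- (octa_s * (octa_t * octa_s))) \<in> ?H"
    by (intro mult s' t)
  have i: "rot 1 qi \<in> ?H"
    using mult(1)[OF u t] by (simp only: octa_relations)
  have j: "rot 1 qj \<in> ?H"
    using mult(1)[OF t u] by (simp only: octa_relations)
  have v: "rot 1 qvarpi \<in> ?H"
    using mult(1)[OF t t] by (simp only: octa_relations)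
  have c: "rot 1 qgamma \<in> ?H"
    using mult(1)[OF m1 mult(1)[OF mult(1)[OF i s] t]] by (simp only: octa_relations)
  have d: "mat \<i> ** rot 1 qdelta \<in> ?H"
    using mult(3)[OF m1 mult(3)[OF mult(1)[OF i j] s']] by (simp only: octa_relations)
  have K: "qk \<in> binary_octahedral" "- (octa_t * qdelta) \<in> binary_octahedral"
    using qdelta_octahedral unfolding binary_octahedral_def octa_t_def
    by (intro qunits_generate generate_S3_mult; auto intro: generate.incl)+
  \<comment> \<open>Elements carrying i must appear as i \<xi> \<delta> with \<xi> in K; here \<xi>
    = -t \<delta>, which is in K because \<delta> is.\<close>
  have t_eq: "octa_t = - (octa_t * qdelta) * qdelta"
    by (simp add: mult.assoc qdelta_square)
  show ?thesis
    unfolding ST13_def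
  proof (rule complex_form_eq_generate[OF binary_octahedral_def])
    show "{qi, qj, qvarpi, qgamma} \<subseteq> {\<xi>. norm \<xi> = 1 \<and> rot 1 \<xi> \<in> ?H}"
      using octa_generator_norms i j v c by auto
    have "mat \<i> ** rot 1 octa_t \<in> complex_form 1 qdelta binary_octahedral"
      unfolding complex_form_def by (subst t_eq) (use K in blast)
    then show "?B \<subseteq> complex_form 1 qdelta binary_octahedral"
      using K by (auto simp: complex_form_def ST_octa_S_rot ST_octa_T_rot octa_s_def)
  qed (use d binary_minus_1 qdelta_square in
      \<open>auto intro: subgroup_rho_closed[OF subgroup_binary(2) qdelta_octahedral]\<close>)
qed

subsection \<open>The icosahedral group\<close>

lemma golden_square: "golden * golden = golden + 1"
  by (simp add: golden_def field_simps)

lemma golden_square_left: "golden * (golden * x) = golden * x + x"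
  using golden_square by (metis distrib_right mult.assoc mult_1)

lemma inverse_golden: "inverse golden = golden - 1"
  by (rule inverse_unique) (simp add: golden_square algebra_simps)

lemma qsigma_sel [simp]:
  "qRe qsigma = (golden - 1) / 2" "qIm1 qsigma = 1/2" "qIm2 qsigma = golden / 2" "qIm3 qsigma = 0"
  by (simp_all add: qsigma_def inverse_golden of_real_def)

definition icosa_x :: quat
  where "icosa_x = Quat (- (1/2)) (- (golden / 2)) (- ((golden - 1) / 2)) 0"

lemma icosa_x_sel [simp]:
  "qRe icosa_x = - (1/2)" "qIm1 icosa_x = - (golden / 2)"
  "qIm2 icosa_x = - ((golden - 1) / 2)" "qIm3 icosa_x = 0"
  by (simp_all add: icosa_x_def)

lemma icosa_generator_norms: "a \<in> {qi, qsigma} \<Longrightarrow> norm a = 1"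
  by (auto simp: norm_quat_eq_1_iff power2_eq_square golden_square field_simps)

text \<open>The rule \<tau>^2 = \<tau> + 1 lowers polynomials in \<tau> to degree at most one, so
  quaternion identities over Q(\<tau>) become linear.\<close>

lemmas quat_golden = quat_eq_iff golden_square golden_square_left field_simps

text \<open>The real part of y is \<tau>/2 = cos(\<pi>/5), so y^5 = -1. The bracketing and signs are
  those that arise for the fifth power of i y.\<close>

lemma icosa_y_power:
  defines "y \<equiv> qi * icosa_x"
  shows "- (y * y) * - (y * y) * y = - 1"
proof -
  have y: "y = Quat (golden / 2) (- (1/2)) 0 (- ((golden - 1) / 2))"
    by (simp add: y_def quat_golden)
  have yy: "- (y * y) = Quat (- ((golden - 1) / 2)) (golden / 2) 0 (1/2)"
    by (simp add: y quat_golden)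
  have y4: "- (y * y) * - (y * y) = Quat (- (golden / 2)) (- (1/2)) 0 (- ((golden - 1) / 2))"
    unfolding yy by (simp add: quat_golden)
  show ?thesis
    unfolding y4 unfolding y by (simp add: quat_golden)
qed

text \<open>The first and third words place \<open>icosa_x\<close> and j in the icosahedral group;
  the second recovers \<sigma> from i and \<open>icosa_x\<close>. Evaluating prefixes to coordinates
  keeps the degree in \<tau> small.\<close>

lemma icosa_words:
  defines "u \<equiv> qsigma * qsigma * qi"
  shows "qi * u * u = icosa_x"
    and "icosa_x * qi * icosa_x * (icosa_x * qi * icosa_x) = qsigma"
    and "qsigma * u * u * (qsigma * qsigma * qsigma) = qj"
proof -
  have u: "u = Quat (- ((golden - 1) / 2)) (- (golden / 2)) 0 (- (1/2))"
    by (simp add: u_def quat_golden)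
  have iu: "qi * u = Quat (golden / 2) (- ((golden - 1) / 2)) (1/2) 0"
    by (simp add: u quat_eq_iff)
  show "qi * u * u = icosa_x"
    unfolding iu unfolding u by (simp add: quat_golden)
  have xix: "icosa_x * qi * icosa_x = Quat (- (golden / 2)) (- ((golden - 1) / 2)) (- (1/2)) 0"
    by (simp add: quat_golden)
  show "icosa_x * qi * icosa_x * (icosa_x * qi * icosa_x) = qsigma"
    unfolding xix by (simp add: quat_golden)
  have ss: "qsigma * qsigma = Quat (- (golden / 2)) ((golden - 1) / 2) (1/2) 0"
    by (simp add: quat_golden)
  have sss: "qsigma * qsigma * qsigma = Quat (- (golden / 2)) (- ((golden - 1) / 2)) (- (1/2)) 0"
    unfolding ss by (simp add: quat_golden)
  have su: "qsigma * u = Quat ((golden - 1) / 2) (- (golden / 2)) 0 (1/2)"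
    by (simp add: u quat_golden)
  have suu: "qsigma * u * u = Quat (- (1/2)) 0 (- (golden / 2)) (- ((golden - 1) / 2))"
    unfolding su unfolding u by (simp add: quat_golden)
  show "qsigma * u * u * (qsigma * qsigma * qsigma) = qj"
    unfolding suu sss by (simp add: quat_golden)
qed

section \<open>Matching the icosahedral generators of Shephard and Todd\<close>

lemma cos_fifth_turn: "cos (2 * pi / 5) = (golden - 1) / 2"
proof -
  define c where "c = cos (2 * pi / 5)"
  \<comment> \<open>For a fifth of a full turn the triple and double angles have the same cosine.
    The resulting cubic has the root 1; what remains is a quadratic whose positive root is
    c.\<close>
  have "cos (3 * (2 * pi / 5)) = cos (2 * pi - 2 * (2 * pi / 5))"
    by simp
  then have "cos (3 * (2 * pi / 5)) = cos (2 * (2 * pi / 5))"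
    by (simp only: cos_2pi_minus)
  then have "4 * c ^ 3 - 3 * c = 2 * c\<^sup>2 - 1"
    by (simp only: cos_treble_cos cos_double_cos c_def)
  then have "(c - 1) * (4 * c\<^sup>2 + 2 * c - 1) = 0"
    by (simp add: algebra_simps power2_eq_square power3_eq_cube)
  moreover have "c \<noteq> 1"
    using cos_monotone_0_pi[of 0 "2 * pi / 5"] by (simp add: c_def)
  moreover have "c > 0"
    unfolding c_def by (rule cos_gt_zero) (use pi_gt_zero in linarith)+
  ultimately have c: "4 * c\<^sup>2 + 2 * c - 1 = 0" "c > 0" by simp_all
  have "(4 * c + 1)\<^sup>2 = 4 * (4 * c\<^sup>2 + 2 * c - 1) + 5"
    by (simp add: power2_eq_square algebra_simps)
  then have "(4 * c + 1)\<^sup>2 = 5" using c by simp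
  then have "4 * c + 1 = sqrt 5"
    using c(2) by (intro real_sqrt_unique[symmetric]) auto
  then show ?thesis by (simp add: golden_def flip: c_def)
qed

text \<open>
  \<open>g\<close> is the rotation about \<open>j\<close> that takes \<open>i\<close> to the axis of \<open>ST_icosa_S\<close>; the quaternion
  \<open>icosa_x\<close> was chosen among the elements of order three so that the same \<open>g\<close> takes it to
  \<open>ST_icosa_T\<close>.
\<close>

lemma icosa_rotation_exists:
  obtains g where "norm g = 1" "ST_icosa_S = rot g qi" "ST_icosa_T = rot g icosa_x"
proof -
  define s where "s = sin (2 * pi / 5)"
  \<comment> \<open>The off-diagonal entries of \<open>ST_icosa_S\<close> are i b and its first
    diagonal entry is -i \<tau> b.\<close>
  define b where "b = 2 * s * (golden - 1) / sqrt 5"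
  have r5: "sqrt 5 = 2 * golden - 1" by (simp add: golden_def field_simps)
  have s2: "s\<^sup>2 = (2 + golden) / 4"
  proof -
    have "s\<^sup>2 = 1 - ((golden - 1) / 2)\<^sup>2"
      by (simp only: s_def sin_squared_eq cos_fifth_turn)
    also have "\<dots> = (2 + golden) / 4"
      by (simp add: power2_eq_square golden_square field_simps)
    finally show ?thesis .
  qed
  have s: "s = golden * b * sqrt 5 / 2"
  proof -
    have "golden * b * sqrt 5 / 2 = golden * (golden - 1) * s"
      by (simp add: b_def)
    also have "golden * (golden - 1) = 1"
      by (simp add: golden_square algebra_simps)
    finally show ?thesis by simp
  qed
  have b2: "b\<^sup>2 = (3 - golden) / 5"
    by (simp add: b_def power_divide power_mult_distrib s2)
      (simp add: power2_eq_square golden_square golden_square_left field_simps)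
  have "(- (golden * b))\<^sup>2 + (- b)\<^sup>2 = (golden * golden + 1) * b\<^sup>2"
    by (simp add: power2_eq_square algebra_simps)
  also have "\<dots> = 1"
    unfolding b2 by (simp add: golden_square field_simps)
  finally have "(- (golden * b))\<^sup>2 + (- b)\<^sup>2 = 1" .
  then obtain \<theta> where \<theta>: "- (golden * b) = cos \<theta>" "- b = sin \<theta>"
    using sincos_total_2pi by metis
  \<comment> \<open>Conjugation by cos(\<theta>/2) + j sin(\<theta>/2) fixes j and takes i to cos
    \<theta> i - sin \<theta> k.\<close>
  define u v where "u = cos (\<theta> / 2)" and "v = sin (\<theta> / 2)"
  have uv: "u * u - v * v = - (golden * b)" "2 * (u * v) = - b" "u * u + v * v = 1"
    using cos_double[of "\<theta> / 2"] sin_double[of "\<theta> / 2"] sin_cos_squared_add2[of "\<theta> / 2"]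
    by (simp_all add: \<theta> u_def v_def power2_eq_square algebra_simps)
  define g where "g = Quat u 0 v 0"
  have g: "norm g = 1"
    using uv(3) by (simp add: norm_quat_eq_1_iff g_def power2_eq_square)
  have gi: "g * qi * inverse g = Quat 0 (- (golden * b)) 0 b"
    using uv by (simp add: inverse_unit_quat[OF g] quat_eq_iff) (simp add: g_def algebra_simps)
  have gj: "g * qj * inverse g = qj"
    using uv by (simp add: inverse_unit_quat[OF g] quat_eq_iff) (simp add: g_def algebra_simps)
  have x: "icosa_x = (- (1/2)) *\<^sub>R 1 + (- (golden / 2)) *\<^sub>R qi + (- ((golden - 1) / 2)) *\<^sub>R qj"
    by (simp add: quat_eq_iff)
  have "g * icosa_x * inverse g = (- (1/2)) *\<^sub>R (g * 1 * inverse g)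
      + (- (golden / 2)) *\<^sub>R (g * qi * inverse g) + (- ((golden - 1) / 2)) *\<^sub>R (g * qj * inverse g)"
    unfolding x by (simp add: distrib_left distrib_right left_diff_distrib right_diff_distrib)
  also have "g * 1 * inverse g = 1"
    using g by (simp add: inverse_unit_quat mult_qcnj)
  finally have gx: "g * icosa_x * inverse g = Quat (- (1/2)) (golden * golden * b / 2)
      (- ((golden - 1) / 2)) (- (golden * b / 2))"
    unfolding gi gj by (simp add: quat_eq_iff)
  define \<eta> where "\<eta> = cis (2 * pi / 5)"
  have \<eta>1: "\<eta> = Complex ((golden - 1) / 2) s"
    by (simp add: \<eta>_def complex_eq_iff cos_fifth_turn s_def)
  have \<eta>2: "\<eta>\<^sup>2 = Complex (- (golden / 2)) (s * (golden - 1))"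
    using s2 by (simp add: \<eta>1 power2_eq_square complex_eq_iff golden_square field_simps)
  \<comment> \<open>This makes \<eta>^4 and \<eta>^3 the conjugates of \<eta> and \<eta>^2, so all
    matrix entries are expressed by \<tau> and s.\<close>
  have "\<eta> ^ 5 = 1" by (simp add: \<eta>_def Complex.DeMoivre)
  have cnj: "cnj \<eta> * \<eta> = 1" by (simp add: \<eta>_def cis_cnj cis_mult)
  have "\<eta> ^ 4 = cnj \<eta> * \<eta> ^ 5"
    using cnj by (simp add: eval_nat_numeral flip: mult.assoc)
  then have \<eta>4: "\<eta> ^ 4 = cnj \<eta>" using \<open>\<eta> ^ 5 = 1\<close> by simp
  have "\<eta> ^ 3 = cnj \<eta> * \<eta> ^ 4"
    using cnj by (simp add: eval_nat_numeral flip: mult.assoc)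
  then have \<eta>3: "\<eta> ^ 3 = cnj (\<eta>\<^sup>2)" by (simp add: \<eta>4 power2_eq_square)
  have "Re \<eta> = (golden - 1) / 2" "Im \<eta> = s" by (simp_all add: \<eta>1)
  note \<eta> = this \<eta>3 \<eta>4 \<eta>2
  have "mat2 (\<eta> ^ 4 - \<eta>) (\<eta>\<^sup>2 - \<eta> ^ 3) (\<eta>\<^sup>2 - \<eta> ^ 3) (\<eta> - \<eta> ^ 4)
      = sqrt 5 *\<^sub>R su2 (Quat 0 (- (golden * b)) 0 b)"
    by (simp add: \<eta> su2_def mat2_eq_iff complex_eq_iff s algebra_simps golden_square golden_square_left)
  then have S: "ST_icosa_S = rot g qi"
    by (simp add: ST_icosa_S_def rot_def gi Let_def flip: \<eta>_def)
  have "mat2 (\<eta>\<^sup>2 - \<eta> ^ 4) (\<eta> ^ 4 - 1) (1 - \<eta>) (\<eta> ^ 3 - \<eta>)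
      = sqrt 5 *\<^sub>R su2 (Quat (- (1/2)) (golden * golden * b / 2)
        (- ((golden - 1) / 2)) (- (golden * b / 2)))"
    by (simp add: \<eta> su2_def mat2_eq_iff complex_eq_iff s algebra_simps golden_square golden_square_left)
      (simp add: r5 field_simps golden_square golden_square_left)
  then have T: "ST_icosa_T = rot g icosa_x"
    by (simp add: ST_icosa_T_def rot_def gx Let_def flip: \<eta>_def)
  show ?thesis using g S T by (rule that)
qed

section \<open>The icosahedral complex form and ST(22)\<close>

lemma binary_icosahedral_members:
  "qj \<in> binary_icosahedral" "icosa_x \<in> binary_icosahedral" "- 1 \<in> binary_icosahedral"
  "- qk \<in> binary_icosahedral"
proof -
  let ?K = "generate S3 {qi, qsigma}"
  have K: "qi \<in> ?K" "qsigma \<in> ?K" by (auto intro: generate.incl)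
  have u: "qsigma * qsigma * qi \<in> ?K"
    by (intro generate_S3_mult K)
  have "qsigma * (qsigma * qsigma * qi) * (qsigma * qsigma * qi) * (qsigma * qsigma * qsigma) \<in> ?K"
    by (intro generate_S3_mult K)
  then have j: "qj \<in> ?K" by (simp only: icosa_words)
  have "qi * (qsigma * qsigma * qi) * (qsigma * qsigma * qi) \<in> ?K"
    by (intro generate_S3_mult K)
  then have "icosa_x \<in> ?K" by (simp only: icosa_words)
  with j K show "qj \<in> binary_icosahedral" "icosa_x \<in> binary_icosahedral"
    "- 1 \<in> binary_icosahedral" "- qk \<in> binary_icosahedral"
    by (simp_all add: binary_icosahedral_def qunits_generate)
qed

lemma subgroup_binary_icosahedral: "subgroup binary_icosahedral S3"
  unfolding binary_icosahedral_def using icosa_generator_norms by (rule subgroup_generate_S3)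

lemma complex_form_icosahedral:
  assumes g: "norm g = 1" and S: "ST_icosa_S = rot g qi" and T: "ST_icosa_T = rot g icosa_x"
  shows "complex_form g qj binary_icosahedral = ST22"
proof -
  let ?B = "{mat \<i> ** ST_icosa_S, ST_icosa_T}"
  let ?H = "generate U2C ?B"
  have g0: "g \<noteq> 0" using g by auto
  note mult = generate_rot_mult[OF g0, of _ ?B]
  have i': "mat \<i> ** rot g qi \<in> ?H" and x: "rot g icosa_x \<in> ?H"
    by (auto intro!: generate.incl simp: S T)
  have y: "mat \<i> ** rot g (qi * icosa_x) \<in> ?H"
    by (intro mult i' x)
  \<comment> \<open>The fifth power of i y is i^5 y^5 = -i. With this scalar in the group, the
    factor i can be removed (\<open>toL\<close>) or inserted (\<open>toM\<close>) at will.\<close>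
  have im1: "mat \<i> ** rot g (- 1) \<in> ?H"
    using mult(3)[OF mult(1)[OF mult(4)[OF y y] mult(4)[OF y y]] y] by (simp only: icosa_y_power)
  have m1: "rot g (- 1) \<in> ?H"
    using mult(4)[OF im1 im1] by simp
  have toL: "rot g z \<in> ?H" if "mat \<i> ** rot g z \<in> ?H" for z
    using mult(4)[OF that im1] by simp
  have toM: "mat \<i> ** rot g z \<in> ?H" if "rot g z \<in> ?H" for z
    using mult(2)[OF im1 mult(1)[OF m1 that]] by simp
  note i = toL[OF i']
  have \<sigma>: "rot g qsigma \<in> ?H"
    using mult(1)[OF mult(1)[OF mult(1)[OF x i] x] mult(1)[OF mult(1)[OF x i] x]]
    by (simp only: icosa_words)
  have u: "rot g (qsigma * qsigma * qi) \<in> ?H"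
    by (intro mult(1) \<sigma> i)
  have "rot g (qsigma * (qsigma * qsigma * qi) * (qsigma * qsigma * qi) *
      (qsigma * qsigma * qsigma)) \<in> ?H"
    by (intro mult(1) \<sigma> i)
  then have j: "mat \<i> ** rot g qj \<in> ?H"
    by (simp only: icosa_words toM)
  show ?thesis
    unfolding ST22_def
  proof (rule complex_form_eq_generate[OF binary_icosahedral_def])
    show "{qi, qsigma} \<subseteq> {\<xi>. norm \<xi> = 1 \<and> rot g \<xi> \<in> ?H}"
      using icosa_generator_norms i \<sigma> by auto
    \<comment> \<open>Since i = (-k) j, the first generator has the form i \<xi> j with \<xi> = -k
      in K.\<close>
    have "mat \<i> ** rot g (- qk * qj) \<in> complex_form g qj binary_icosahedral"
      unfolding complex_form_def using binary_icosahedral_members(4) by blast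
    then show "?B \<subseteq> complex_form g qj binary_icosahedral"
      using binary_icosahedral_members by (auto simp: complex_form_def S T quat_units_mult)
  qed (use j g0 binary_icosahedral_members quat_units_mult in
      \<open>auto intro: subgroup_rho_closed[OF subgroup_binary_icosahedral]\<close>)
qed

theorem theorem7p3:
  shows
    "(conjugate_in U2H (Ggroup binary_tetrahedral {1} (image (rho qdelta))) (complex_type ST12) \<and>
      conjugate_in U2H (Ggroup binary_octahedral {1} (image (rho qdelta))) (complex_type ST13) \<and>
      conjugate_in U2H (Ggroup binary_icosahedral {1} (image (rho qj))) (complex_type ST22)) \<and>
     (\<forall>r :: real.
        reflR r qdelta \<in> normalizer U2H (Ggroup binary_tetrahedral {1} (image (rho qdelta))) \<and>
        reflR r qdelta \<in> normalizer U2H (Ggroup binary_octahedral {1} (image (rho qdelta))) \<and>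
        reflR r qj \<in> normalizer U2H (Ggroup binary_icosahedral {1} (image (rho qj))))"
proof -
  obtain g where g: "norm g = 1" "ST_icosa_S = rot g qi" "ST_icosa_T = rot g icosa_x"
    by (rule icosa_rotation_exists)
  \<comment> \<open>The twisting automorphisms are inner here, as \<delta> and j lie in the
    respective groups.\<close>
  note octa = subgroup_rho_closed[OF subgroup_binary(2) qdelta_octahedral]
    and icosa = subgroup_rho_closed[OF subgroup_binary_icosahedral binary_icosahedral_members(1)]
  show ?thesis
    using conjugate_in_complex_form[OF subgroup_binary(1) norm_one qdelta_square tetrahedral_normalised]
      conjugate_in_complex_form[OF subgroup_binary(2) norm_one qdelta_square octa]
      conjugate_in_complex_form[OF subgroup_binary_icosahedral g(1) quat_units_mult(2) icosa]
      reflR_in_normalizer[OF subgroup_binary(1) qdelta_square binary_minus_1(1) tetrahedral_normalised]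
      reflR_in_normalizer[OF subgroup_binary(2) qdelta_square binary_minus_1(2) octa]
      reflR_in_normalizer[OF subgroup_binary_icosahedral quat_units_mult(2)
        binary_icosahedral_members(3) icosa]
    by (simp add: complex_form_tetrahedral complex_form_octahedral complex_form_icosahedral[OF g])
qed

end
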